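(* Let $\mathcal{H}$ be a Hilbert space and let $1<p<\infty$, $q=p/(p-1)$, $p^*=\max\{p,p/(p-1)\}$. Let $B_p:\mathcal{D}_p\to\mathbb{R}$ be the function given by $B_p=\mathcal{B}_p$ if $1<p\le 2$, and by $B_p(\zeta,\eta,Z,H)=\mathcal{B}_q(\eta,\zeta,H,Z)$ if $p>2$ (where $\mathcal{D}_p$ and $\mathcal{B}_p$ are defined in the context). Then: (I) $0\le B_p(\zeta,\eta,Z,H)\le (p^*-1)Z^{1/p}H^{1/q}$ for all $(\zeta,\eta,Z,H)\in\mathcal{D}_p$. (II) For any $a_\pm=(\zeta_\pm,\eta_\pm,Z_\pm,H_\pm)\in\mathcal{D}_p$, $$B_p\left(\frac{a_-+a_+}{2}\right)-\frac{B_p(a_-)+B_p(a_+)}{2}\ge \left|\frac{\zeta_+-\zeta_-}{2}\right|\left|\frac{\eta_+-\eta_-}{2}\right|.$$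
   Context: $|\cdot|$ denotes the norm of $\mathcal{H}$. For $1<p<\infty$ with conjugate exponent $q=p/(p-1)$, put $$\mathcal{D}_p=\{(\zeta,\eta,Z,H)\in\mathcal{H}\times\mathcal{H}\times[0,\infty)\times[0,\infty): Z\ge|\zeta|^p,\ H\ge|\eta|^q\}.$$ For $1<p\le 2$ the function $\mathcal{B}_p:\mathcal{D}_p\to\mathbb{R}$ is defined as follows. - If $|\eta|^qZ\ge|\zeta|^pH$, then $$\mathcal{B}_p(\zeta,\eta,Z,H)=\frac{(H-|\eta|^q)^{1/q}(Z-|\zeta|^p)^{1/p}}{p-1}.$$ - If $|\eta|^qZ<|\zeta|^pH$ and $Z>|\zeta|^p$, then $$\mathcal{B}_p(\zeta,\eta,Z,H)=\gamma Z^{1/p}H^{1/q}-|\zeta||\eta|Y,$$ where $(\gamma,Y)$, $0\le Y<\gamma<(p-1)^{-1}$, is the unique solution (it exists and is unique) of the system $$\frac{(1-(p-1)Y)(1+Y)^{p-1}}{(1-(p-1)\gamma)(1+\gamma)^{p-1}}=\frac{Z}{|\zeta|^p},\qquad \frac{Y(1+Y)^{p-2}}{\gamma(1+\gamma)^{p-2}}=\left(\frac{|\eta|^qZ}{|\zeta|^pH}\right)^{1/q}.$$ - If $|\eta|^qZ<|\zeta|^pH$ and $Z=|\zeta|^p$, then $\mathcal{B}_p(\zeta,\eta,Z,H)=0$. For $p>2$ we have $1<q<2$, the conjugate exponent of $q$ is $p$, and $(\eta,\zeta,H,Z)\in\mathcal{D}_q$ whenever $(\zeta,\eta,Z,H)\in\mathcal{D}_p$,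 so $\mathcal{B}_q(\eta,\zeta,H,Z)$ is well defined. *)

theory Defs
  imports "HOL-Analysis.Analysis"
begin

definition conj_exponent :: "real \<Rightarrow> real" where
  "conj_exponent p = p / (p - 1)"

definition bellman_dom :: "real \<Rightarrow> ('a::real_inner \<times> 'a \<times> real \<times> real) set" where
  "bellman_dom p = {(\<zeta>, \<eta>, Z, H). 0 \<le> Z \<and> 0 \<le> H \<and>
     Z \<ge> norm \<zeta> powr p \<and> H \<ge> norm \<eta> powr conj_exponent p}"

text \<open>
  All bases of \<open>powr\<close> below are nonnegative, so the library value \<open>0 powr a = 0\<close> is the
  intended one. The system is only used under the hypotheses
  \<open>norm \<eta> powr q * Z < norm \<zeta> powr p * H\<close> and \<open>Z > norm \<zeta> powr p\<close>; these and
  \<open>0 \<le> Y < \<gamma> < 1 / (p - 1)\<close> make every denominator positive.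
\<close>

definition bellman_system ::
  "real \<Rightarrow> 'a::real_inner \<times> 'a \<times> real \<times> real \<Rightarrow> real \<Rightarrow> real \<Rightarrow> bool" where
  "bellman_system p = (\<lambda>(\<zeta>, \<eta>, Z, H) \<gamma> Y.
     0 \<le> Y \<and> Y < \<gamma> \<and> \<gamma> < 1 / (p - 1) \<and>
     ((1 - (p - 1) * Y) * (1 + Y) powr (p - 1)) /
       ((1 - (p - 1) * \<gamma>) * (1 + \<gamma>) powr (p - 1)) = Z / norm \<zeta> powr p \<and>
     (Y * (1 + Y) powr (p - 2)) / (\<gamma> * (1 + \<gamma>) powr (p - 2)) =
       ((norm \<eta> powr conj_exponent p * Z) / (norm \<zeta> powr p * H)) powr (1 / conj_exponent p))"

text \<open>
  Meaningful for \<open>1 < p \<le> 2\<close> on \<open>bellman_dom p\<close>, where the final \<open>else\<close> branch is the case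
  \<open>Z = norm \<zeta> powr p\<close>.
\<close>

definition cal_B :: "real \<Rightarrow> 'a::real_inner \<times> 'a \<times> real \<times> real \<Rightarrow> real" where
  "cal_B p = (\<lambda>(\<zeta>, \<eta>, Z, H). let q = conj_exponent p in
     if norm \<eta> powr q * Z \<ge> norm \<zeta> powr p * H then
       (H - norm \<eta> powr q) powr (1 / q) * (Z - norm \<zeta> powr p) powr (1 / p) / (p - 1)
     else if Z > norm \<zeta> powr p then
       (let (\<gamma>, Y) = (THE (\<gamma>, Y). bellman_system p (\<zeta>, \<eta>, Z, H) \<gamma> Y)
        in \<gamma> * Z powr (1 / p) * H powr (1 / q) - norm \<zeta> * norm \<eta> * Y)
     else 0)"

definition bellman_B :: "real \<Rightarrow> 'a::real_inner \<times> 'a \<times> real \<times> real \<Rightarrow> real" where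
  "bellman_B p = (\<lambda>(\<zeta>, \<eta>, Z, H).
     if p \<le> 2 then cal_B p (\<zeta>, \<eta>, Z, H) else cal_B (conj_exponent p) (\<eta>, \<zeta>, H, Z))"

end

theory Submission
  imports Defs
begin

text \<open>
  By symmetry let \<open>1 < p \<le> 2\<close>. An infimum of functions satisfying the midpoint inequality (II)
  satisfies it again, so it suffices to write the Bellman function as the infimum over \<open>y\<close> and \<open>\<phi>\<close> of
  \<open>(C Z + \<phi>(\<zeta>, y))\<^sup>1\<^sup>/\<^sup>p H\<^sup>1\<^sup>/\<^sup>q - \<langle>y, \<eta>\<rangle>\<close>, where \<open>\<phi>\<close> is zigzag concave, i.e. midpoint concave along all
  directions \<open>(h, k)\<close> with \<open>|k| \<le> |h|\<close>, and majorizes \<open>|y|\<^sup>p - C |\<zeta>|\<^sup>p\<close>. For such an expression (II)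
  follows by moving \<open>y\<close> to \<open>y \<plusminus> k\<close> with \<open>k\<close> parallel to \<open>\<eta>\<^sub>+ - \<eta>\<^sub>-\<close> and \<open>2|k| = |\<zeta>\<^sub>+ - \<zeta>\<^sub>-|\<close>, and applying
  Hoelder's inequality. The functions \<open>\<phi>\<close> are the multiples of Burkholder's function
  \<open>-(|\<zeta>| - (p - 1)|y|) (|\<zeta>| + |y|)\<^sup>p\<^sup>-\<^sup>1\<close> that touch the obstacle at \<open>|y| = \<gamma> |\<zeta>|\<close>, and Burkholder's minimal
  majorant for the best constant \<open>C = (p - 1)\<^sup>-\<^sup>p\<close>. The system for \<open>(\<gamma>, Y)\<close> is the criticality condition
  for \<open>\<gamma>\<close> and \<open>|y| = Y |\<zeta>|\<close>.
\<close>

section \<open>Zigzag concavity\<close>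

definition zigzag_concave :: "('a::real_inner \<Rightarrow> 'a \<Rightarrow> real) \<Rightarrow> bool" where
  "zigzag_concave f \<longleftrightarrow>
     (\<forall>x y h k. norm k \<le> norm h \<longrightarrow> f (x + h) (y + k) + f (x - h) (y - k) \<le> 2 * f x y)"

text \<open>After subtraction of the chord through the values at -1 and 1, failure of the claim
  would give the remainder \<open>f\<close> a negative minimum over \<open>{-1..1}\<close>, attained
  away from the endpoints. Local midpoint concavity at a minimizer produces further minimizers on
  both sides of it.\<close>

lemma locally_midpoint_concave_imp_midpoint_concave:
  fixes g :: "real \<Rightarrow> real"
  assumes cont: "continuous_on UNIV g"
    and loc: "\<And>t. \<forall>\<^sub>F u in at_right 0. g (t + u) + g (t - u) \<le> 2 * g t"
  shows "g 1 + g (-1) \<le> 2 * g 0"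
proof (rule ccontr)
  assume neg: "\<not> ?thesis"
  define c where "c = (g 1 + g (-1)) / 2"
  define d where "d = (g 1 - g (-1)) / 2"
  define f where "f t = g t - c - d * t" for t
  have f_ends: "f 1 = 0" "f (-1) = 0" and f0: "f 0 < 0"
    using neg by (auto simp: f_def c_def d_def field_simps)
  have contf: "continuous_on S f" for S
    unfolding f_def by (intro continuous_intros continuous_on_subset[OF cont]) auto
  have "\<exists>t\<in>{-1..1}. \<forall>s\<in>{-1..1}. f t \<le> f s"
    by (rule continuous_attains_inf) (auto intro: contf)
  then obtain t0 where t0: "t0 \<in> {-1..1}" "\<And>s. s \<in> {-1..1} \<Longrightarrow> f t0 \<le> f s"
    by blast
  \<comment> \<open>The last minimizer \<open>b\<close> of \<open>f\<close> is interior, and local midpoint concavity there pushes it further right.\<close>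
  define N where "N = {t \<in> {-1..1}. f t = f t0}"
  have "closed N"
    unfolding N_def by (rule continuous_closed_preimage_constant[OF contf]) simp
  moreover have "N \<noteq> {}" using t0 by (auto simp: N_def)
  moreover have bdd: "bdd_above N" by (rule bdd_aboveI[of _ 1]) (auto simp: N_def)
  ultimately have "Sup N \<in> N" by (simp add: closed_contains_Sup)
  define b where "b = Sup N"
  have b: "b \<in> {-1..1}" "f b = f t0" using \<open>Sup N \<in> N\<close> by (auto simp: N_def b_def)
  have "f t0 < 0" using t0(2)[of 0] f0 by simp
  then have b': "-1 < b" "b < 1"
    using b f_ends by (auto simp: less_le)
  have "\<forall>\<^sub>F u in at_right 0. u < min (1 - b) (b + 1)"
    using b' by (intro eventually_at_right_less eventually_at_rightI[of 0 "min (1 - b) (b + 1)"]) auto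
  moreover have "\<forall>\<^sub>F u::real in at_right 0. 0 < u" by (rule eventually_at_right_less)
  ultimately have "\<forall>\<^sub>F u in at_right 0. 0 < u \<and> u < 1 - b \<and> u < b + 1 \<and> g (b + u) + g (b - u) \<le> 2 * g b"
    using loc[of b] by eventually_elim auto
  then obtain u where u: "0 < u" "u < 1 - b" "u < b + 1" "g (b + u) + g (b - u) \<le> 2 * g b"
    using eventually_happens' trivial_limit_at_right_real by blast
  have "f (b + u) + f (b - u) \<le> 2 * f b" using u(4) by (simp add: f_def algebra_simps)
  moreover have "f b \<le> f (b + u)" "f b \<le> f (b - u)"
    using t0(2)[of "b + u"] t0(2)[of "b - u"] u b by auto
  ultimately have "f (b + u) = f b" by simp
  then have "b + u \<in> N" using b u by (auto simp: N_def)
  then have "b + u \<le> b" unfolding b_def by (rule cSup_upper) (rule bdd)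
  then show False using u by simp
qed

text \<open>This lets a piecewise defined function be tested near one point at a time. On the line
  through a point in direction (h, k) the hypothesis is the local condition of the previous lemma at
  every parameter t.\<close>

lemma zigzag_concaveI_local:
  fixes f :: "'a::real_inner \<Rightarrow> 'a \<Rightarrow> real"
  assumes cont: "continuous_on UNIV (\<lambda>(x, y). f x y)"
    and loc: "\<And>x y h k. norm k \<le> norm h \<Longrightarrow>
      \<forall>\<^sub>F u in at_right (0::real). f (x + u *\<^sub>R h) (y + u *\<^sub>R k) + f (x - u *\<^sub>R h) (y - u *\<^sub>R k) \<le> 2 * f x y"
  shows "zigzag_concave f"
  unfolding zigzag_concave_def
proof (intro allI impI)
  fix x y h k :: 'a
  assume hk: "norm k \<le> norm h"
  define g where "g t = f (x + t *\<^sub>R h) (y + t *\<^sub>R k)" for t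
  have "g 1 + g (-1) \<le> 2 * g 0"
  proof (rule locally_midpoint_concave_imp_midpoint_concave)
    have "continuous_on UNIV ((\<lambda>(x, y). f x y) \<circ> (\<lambda>t. (x + t *\<^sub>R h, y + t *\<^sub>R k)))"
      by (intro continuous_on_compose continuous_intros continuous_on_subset[OF cont]) auto
    then show "continuous_on UNIV g" by (simp add: g_def o_def)
    show "\<forall>\<^sub>F u in at_right 0. g (t + u) + g (t - u) \<le> 2 * g t" for t
      using loc[OF hk, of "x + t *\<^sub>R h" "y + t *\<^sub>R k"]
      by eventually_elim (simp add: g_def algebra_simps)
  qed
  then show "f (x + h) (y + k) + f (x - h) (y - k) \<le> 2 * f x y"
    by (simp add: g_def)
qed

text \<open>
  Integrating these functions over all scales \<open>t\<close> against \<open>t powr (p - 3)\<close> yields a multiple of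
  Burkholder's function for \<open>1 < p < 2\<close>; each of them is trivially zigzag concave near every point.
\<close>

definition zigzag_block :: "real \<Rightarrow> 'a::real_inner \<Rightarrow> 'a \<Rightarrow> real" where
  "zigzag_block t x y = (if norm x + norm y \<le> t then (norm y)\<^sup>2 - (norm x)\<^sup>2 else t\<^sup>2 - 2 * t * norm x)"

section \<open>Zigzag concavity of the blocks\<close>

lemma parallelogram:
  fixes x h :: "'a::real_inner"
  shows "(norm (x + h))\<^sup>2 + (norm (x - h))\<^sup>2 = 2 * (norm x)\<^sup>2 + 2 * (norm h)\<^sup>2"
  by (simp add: power2_norm_eq_inner inner_add inner_diff inner_commute)

text \<open>By the parallelogram law the second difference equals 2|k|^2 - 2|h|^2.\<close>

lemma zigzag_concave_norm_diff:
  "zigzag_concave (\<lambda>x y::'a::real_inner. (norm y)\<^sup>2 - (norm x)\<^sup>2)"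
  unfolding zigzag_concave_def
proof (intro allI impI)
  fix x y h k :: 'a
  assume "norm k \<le> norm h"
  then have "(norm k)\<^sup>2 \<le> (norm h)\<^sup>2" by (intro power_mono) auto
  moreover have "b1 - a1 + (b2 - a2) \<le> 2 * (b - a)"
    if "k \<le> h" "a1 + a2 = 2 * a + 2 * h" "b1 + b2 = 2 * b + 2 * k" for a1 a2 b1 b2 a b h k :: real
    using that by argo
  ultimately show "(norm (y + k))\<^sup>2 - (norm (x + h))\<^sup>2 + ((norm (y - k))\<^sup>2 - (norm (x - h))\<^sup>2)
      \<le> 2 * ((norm y)\<^sup>2 - (norm x)\<^sup>2)"
    using parallelogram by blast
qed

lemma norm_midpoint_le:
  fixes x h :: "'a::real_inner"
  shows "2 * norm x \<le> norm (x + h) + norm (x - h)"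
proof -
  have "2 * norm x = norm ((x + h) + (x - h))" by (simp flip: scaleR_2)
  also have "\<dots> \<le> norm (x + h) + norm (x - h)" by (rule norm_triangle_ineq)
  finally show ?thesis .
qed

text \<open>Where |x| + |y| < t the block is locally the quadratic form above. At any other point it
  is compared with t^2 - 2t|x|, which has the same value there, dominates the block everywhere, is
  concave in x and does not involve y.\<close>

lemma zigzag_concave_block:
  assumes "0 \<le> t"
  shows "zigzag_concave (zigzag_block t :: 'a::real_inner \<Rightarrow> 'a \<Rightarrow> real)"
proof (rule zigzag_concaveI_local)
  have "continuous_on ({z::'a\<times>'a. norm (fst z) + norm (snd z) \<le> t} \<union> {z. t \<le> norm (fst z) + norm (snd z)})
    (\<lambda>z. if norm (fst z) + norm (snd z) \<le> t then (norm (snd z))\<^sup>2 - (norm (fst z))\<^sup>2 else t\<^sup>2 - 2 * t * norm (fst z))"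
  proof (rule continuous_on_If)
    fix z :: "'a \<times> 'a"
    assume "z \<in> {z. norm (fst z) + norm (snd z) \<le> t}" "\<not> norm (fst z) + norm (snd z) \<le> t"
    then show "(norm (snd z))\<^sup>2 - (norm (fst z))\<^sup>2 = t\<^sup>2 - 2 * t * norm (fst z)" by simp
  next
    fix z :: "'a \<times> 'a"
    assume "z \<in> {z. t \<le> norm (fst z) + norm (snd z)}" "norm (fst z) + norm (snd z) \<le> t"
    then have t: "t = norm (fst z) + norm (snd z)" by simp
    show "(norm (snd z))\<^sup>2 - (norm (fst z))\<^sup>2 = t\<^sup>2 - 2 * t * norm (fst z)"
      unfolding t by (simp add: power2_eq_square algebra_simps)
  qed (auto intro!: closed_Collect_le continuous_intros)
  moreover have "{z::'a\<times>'a. norm (fst z) + norm (snd z) \<le> t} \<union> {z. t \<le> norm (fst z) + norm (snd z)} = UNIV"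
    by auto
  ultimately show "continuous_on UNIV (\<lambda>(x::'a, y). zigzag_block t x y)"
    by (simp add: zigzag_block_def case_prod_unfold)
next
  fix x y h k :: 'a
  assume hk: "norm k \<le> norm h"
  show "\<forall>\<^sub>F u in at_right (0::real). zigzag_block t (x + u *\<^sub>R h) (y + u *\<^sub>R k)
      + zigzag_block t (x - u *\<^sub>R h) (y - u *\<^sub>R k) \<le> 2 * zigzag_block t x y"
  proof (cases "norm x + norm y < t")
    case True
    have "\<forall>\<^sub>F u in at_right (0::real). norm (x + u *\<^sub>R h) + norm (y + u *\<^sub>R k) < t"
      by (rule order_tendstoD(2)[OF _ True]) (auto intro!: tendsto_eq_intros)
    moreover have "\<forall>\<^sub>F u in at_right (0::real). norm (x - u *\<^sub>R h) + norm (y - u *\<^sub>R k) < t"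
      by (rule order_tendstoD(2)[OF _ True]) (auto intro!: tendsto_eq_intros)
    ultimately show ?thesis
    proof eventually_elim
      case (elim u)
      have "norm (u *\<^sub>R k) \<le> norm (u *\<^sub>R h)"
        using hk by (auto intro: mult_left_mono)
      then have "(norm (y + u *\<^sub>R k))\<^sup>2 - (norm (x + u *\<^sub>R h))\<^sup>2
          + ((norm (y - u *\<^sub>R k))\<^sup>2 - (norm (x - u *\<^sub>R h))\<^sup>2) \<le> 2 * ((norm y)\<^sup>2 - (norm x)\<^sup>2)"
        using zigzag_concave_norm_diff unfolding zigzag_concave_def by blast
      then show ?case
        using elim True by (simp add: zigzag_block_def)
    qed
  next
    case False
    \<comment> \<open>On the inner region the gap between the two branches is (t - |x|)^2 - |y|^2,
      which is nonnegative there.\<close>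
    have le: "zigzag_block t x y \<le> t\<^sup>2 - 2 * t * norm x" for x y :: 'a
    proof (cases "norm x + norm y \<le> t")
      case True
      then have "(norm y)\<^sup>2 \<le> (t - norm x)\<^sup>2" by (intro power_mono) auto
      then show ?thesis using True by (simp add: zigzag_block_def power2_eq_square algebra_simps)
    qed (simp add: zigzag_block_def)
    have eq: "zigzag_block t x y = t\<^sup>2 - 2 * t * norm x"
    proof (cases "norm x + norm y \<le> t")
      case True
      then have t: "t = norm x + norm y" using False by simp
      show ?thesis unfolding t by (simp add: zigzag_block_def power2_eq_square algebra_simps)
    qed (simp add: zigzag_block_def)
    have "zigzag_block t (x + h') (y + k') + zigzag_block t (x - h') (y - k') \<le> 2 * zigzag_block t x y" for h' k'
    proof -
      have "t * (2 * norm x) \<le> t * (norm (x + h') + norm (x - h'))"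
        by (rule mult_left_mono[OF norm_midpoint_le assms])
      then show ?thesis using le[of "x + h'" "y + k'"] le[of "x - h'" "y - k'"] eq
        by (simp add: algebra_simps)
    qed
    then show ?thesis by simp
  qed
qed

section \<open>Burkholder's function as a superposition of blocks\<close>

definition burk_W :: "real \<Rightarrow> real \<Rightarrow> real \<Rightarrow> real" where
  "burk_W p r s = (r - (p - 1) * s) * (r + s) powr (p - 1)"

text \<open>The integral is split at \<open>\<sigma>\<close> = |x| + |y|, where the block changes
  branch. Stopping at a finite T instead of infinity leaves the last term, a multiple of |y|^2 -
  |x|^2.\<close>

lemma has_integral_zigzag_block:
  fixes x y :: "'a::real_inner"
  assumes p: "1 < p" "p < 2" and T: "norm x + norm y \<le> T" "0 < T"
  shows "((\<lambda>t. t powr (p - 3) * zigzag_block t x y) has_integral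
     - (2 / (p * (p - 1) * (2 - p))) * burk_W p (norm x) (norm y)
     - ((norm y)\<^sup>2 - (norm x)\<^sup>2) * T powr (p - 2) / (2 - p)) {0..T}"
proof -
  define r s \<sigma> where "r = norm x" and "s = norm y" and "\<sigma> = r + s"
  have rs: "0 \<le> r" "0 \<le> s" "0 \<le> \<sigma>" "\<sigma> \<le> T" using T by (auto simp: r_def s_def \<sigma>_def)
  show ?thesis
  proof (cases "\<sigma> = 0")
    case True
    then have "r = 0" "s = 0" using rs by (auto simp: \<sigma>_def)
    then have "x = 0" "y = 0" by (auto simp: r_def s_def)
    moreover have "((\<lambda>t::real. t powr (p - 3) * zigzag_block t (0::'a) 0) has_integral 0) {0..T}"
      by (rule has_integral_is_0) (auto simp: zigzag_block_def)
    ultimately show ?thesis by (simp add: burk_W_def)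
  next
    case False
    then have \<sigma>: "0 < \<sigma>" using rs by simp
    \<comment> \<open>For p < 2 the power \<open>t powr (p - 2)\<close> is singular at 0, so the
      derivative is only required in the open interval; the antiderivative is continuous up to 0
      because p > 1.\<close>
    have 1: "((\<lambda>t. t powr (p - 1) - 2 * r * t powr (p - 2)) has_integral
        (\<sigma> powr p / p - 2 * r * \<sigma> powr (p - 1) / (p - 1)) - (0 powr p / p - 2 * r * 0 powr (p - 1) / (p - 1))) {0..\<sigma>}"
    proof (rule fundamental_theorem_of_calculus_interior)
      show "continuous_on {0..\<sigma>} (\<lambda>t. t powr p / p - 2 * r * t powr (p - 1) / (p - 1))"
        using p by (intro continuous_intros continuous_on_powr') auto
      fix t assume "t \<in> {0<..<\<sigma>}"
      then have "((\<lambda>t. t powr p / p - 2 * r * t powr (p - 1) / (p - 1)) has_real_derivative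
          p * t powr (p - 1) / p - 2 * r * ((p - 1) * t powr (p - 1 - 1)) / (p - 1)) (at t)"
        by (intro derivative_intros DERIV_cdivide DERIV_cmult has_real_derivative_powr) auto
      then show "((\<lambda>t. t powr p / p - 2 * r * t powr (p - 1) / (p - 1)) has_vector_derivative
          t powr (p - 1) - 2 * r * t powr (p - 2)) (at t)"
        using p by (simp add: has_real_derivative_iff_has_vector_derivative mult.assoc)
    qed (use rs in auto)
    have 1: "((\<lambda>t. t powr (p - 3) * zigzag_block t x y) has_integral
        \<sigma> powr p / p - 2 * r * \<sigma> powr (p - 1) / (p - 1)) {0..\<sigma>}"
    proof (rule has_integral_spike_finite[where S = "{0,\<sigma>}"])
      show "((\<lambda>t. t powr (p - 1) - 2 * r * t powr (p - 2)) has_integral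
        \<sigma> powr p / p - 2 * r * \<sigma> powr (p - 1) / (p - 1)) {0..\<sigma>}" using 1 p by simp
      fix t assume t: "t \<in> {0..\<sigma>} - {0,\<sigma>}"
      then have "t powr (p - 1) = t powr (p - 3) * t\<^sup>2" "t powr (p - 2) = t powr (p - 3) * t"
        by (simp_all add: powr_diff field_simps power2_eq_square power3_eq_cube)
      then show "t powr (p - 3) * zigzag_block t x y = t powr (p - 1) - 2 * r * t powr (p - 2)"
        using t by (simp add: zigzag_block_def r_def s_def \<sigma>_def algebra_simps)
    qed auto
    have 2: "((\<lambda>t. t powr (p - 3) * (s\<^sup>2 - r\<^sup>2)) has_integral
        (s\<^sup>2 - r\<^sup>2) * T powr (p - 2) / (p - 2) - (s\<^sup>2 - r\<^sup>2) * \<sigma> powr (p - 2) / (p - 2)) {\<sigma>..T}"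
    proof (rule fundamental_theorem_of_calculus)
      fix t assume t: "t \<in> {\<sigma>..T}"
      have "((\<lambda>t. (s\<^sup>2 - r\<^sup>2) * t powr (p - 2) / (p - 2)) has_real_derivative
          (s\<^sup>2 - r\<^sup>2) * ((p - 2) * t powr (p - 2 - 1)) / (p - 2)) (at t)"
        using t \<sigma> by (intro DERIV_cdivide DERIV_cmult has_real_derivative_powr) auto
      from has_field_derivative_at_within[OF this, of "{\<sigma>..T}"]
      show "((\<lambda>t. (s\<^sup>2 - r\<^sup>2) * t powr (p - 2) / (p - 2)) has_vector_derivative t powr (p - 3) * (s\<^sup>2 - r\<^sup>2)) (at t within {\<sigma>..T})"
        using p by (simp add: has_real_derivative_iff_has_vector_derivative mult.commute)
    qed (use rs in auto)
    have 2: "((\<lambda>t. t powr (p - 3) * zigzag_block t x y) has_integral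
        (s\<^sup>2 - r\<^sup>2) * T powr (p - 2) / (p - 2) - (s\<^sup>2 - r\<^sup>2) * \<sigma> powr (p - 2) / (p - 2)) {\<sigma>..T}"
      by (rule has_integral_eq[OF _ 2]) (auto simp: zigzag_block_def r_def s_def \<sigma>_def)
    have pw: "\<sigma> powr p = \<sigma> powr (p - 2) * \<sigma>\<^sup>2" "\<sigma> powr (p - 1) = \<sigma> powr (p - 2) * \<sigma>"
      using \<sigma> by (simp_all add: powr_diff field_simps power2_eq_square)
    have "\<sigma> powr p / p - 2 * r * \<sigma> powr (p - 1) / (p - 1)
       + ((s\<^sup>2 - r\<^sup>2) * T powr (p - 2) / (p - 2) - (s\<^sup>2 - r\<^sup>2) * \<sigma> powr (p - 2) / (p - 2))
       = - (2 / (p * (p - 1) * (2 - p))) * burk_W p r s - (s\<^sup>2 - r\<^sup>2) * T powr (p - 2) / (2 - p)"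
    proof -
      have nz: "p \<noteq> 0" "p - 1 \<noteq> 0" "2 - p \<noteq> 0" "p - 2 \<noteq> 0" using p by auto
      \<comment> \<open>Once \<open>\<sigma> powr (p - 2)\<close> is factored out, a rational
        identity in r, s and p remains.\<close>
      have a: "\<sigma>\<^sup>2 / p - 2 * r * \<sigma> / (p - 1) + (s\<^sup>2 - r\<^sup>2) / (2 - p) =
         - (2 / (p * (p - 1) * (2 - p))) * ((r - (p - 1) * s) * \<sigma>)"
        using nz unfolding \<sigma>_def by (simp add: divide_simps) algebra
      have b: "z / (p - 2) = - (z / (2 - p))" for z
        using nz by (simp add: divide_simps) (simp add: algebra_simps)
      define c where "c = 2 / (p * (p - 1) * (2 - p))"
      define e where "e = \<sigma> powr (p - 2)"
      have "e * \<sigma>\<^sup>2 / p - 2 * r * (e * \<sigma>) / (p - 1) + (s\<^sup>2 - r\<^sup>2) * e / (2 - p)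
          = e * (\<sigma>\<^sup>2 / p - 2 * r * \<sigma> / (p - 1) + (s\<^sup>2 - r\<^sup>2) / (2 - p))"
        by (simp add: distrib_left right_diff_distrib mult_ac)
      also have "\<dots> = - c * ((r - (p - 1) * s) * (e * \<sigma>))"
        unfolding a c_def[symmetric] by (simp add: mult_ac)
      finally show ?thesis
        unfolding b burk_W_def \<sigma>_def[symmetric] pw c_def[symmetric] e_def[symmetric] by simp
    qed
    with has_integral_combine[OF _ _ 1 2] rs show ?thesis by (simp add: r_def s_def)
  qed
qed

text \<open>For p < 2 a positive multiple of \<open>- burk_W\<close> is the truncated integral of
  the blocks plus a nonnegative multiple of |y|^2 - |x|^2 that undoes the truncation; both summands
  are zigzag concave. For p = 2 the function is |y|^2 - |x|^2 itself.\<close>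

lemma zigzag_concave_burk_W:
  assumes p: "1 < p" "p \<le> 2"
  shows "zigzag_concave (\<lambda>(x::'a::real_inner) y. - burk_W p (norm x) (norm y))"
  unfolding zigzag_concave_def
proof (intro allI impI)
  fix x y h k :: 'a
  assume hk: "norm k \<le> norm h"
  define Q where "Q = (\<lambda>(x::'a) y::'a. (norm y)\<^sup>2 - (norm x)\<^sup>2)"
  define W where "W = (\<lambda>(x::'a) y::'a. burk_W p (norm x) (norm y))"
  have Q: "Q (x + h) (y + k) + Q (x - h) (y - k) \<le> 2 * Q x y"
    using zigzag_concave_norm_diff[where 'a='a] hk unfolding zigzag_concave_def Q_def by blast
  have "2 * W x y \<le> W (x + h) (y + k) + W (x - h) (y - k)"
  proof (cases "p = 2")
    case True
    have "W x y = - Q x y" for x y :: 'a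
      using norm_ge_zero[of x] norm_ge_zero[of y] True
      by (cases "norm x + norm y = 0") (auto simp: W_def Q_def burk_W_def algebra_simps power2_eq_square)
    then show ?thesis using Q by simp
  next
    case False
    then have p2: "p < 2" using p by simp
    \<comment> \<open>One truncation level serves all three points, so that the integrals can be
      compared over the same interval; the summand 1 keeps it positive.\<close>
    define T where "T = 1 + norm x + norm y + norm h + norm k"
    define c where "c = 2 / (p * (p - 1) * (2 - p))"
    define d where "d = T powr (p - 2) / (2 - p)"
    have c: "0 < c" and d: "0 \<le> d" using p p2 by (auto simp: c_def d_def)
    have I: "((\<lambda>t. t powr (p - 3) * zigzag_block t a b) has_integral - c * W a b - d * Q a b) {0..T}"
      if "norm a + norm b \<le> T" for a b :: 'a
      using has_integral_zigzag_block[OF p(1) p2 that] 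
      by (simp add: c_def d_def W_def Q_def T_def add_pos_nonneg mult.commute)
    have T: "norm x + norm y \<le> T" "norm (x + h) + norm (y + k) \<le> T" "norm (x - h) + norm (y - k) \<le> T"
      using norm_triangle_ineq[of x h] norm_triangle_ineq[of y k]
        norm_triangle_ineq4[of x h] norm_triangle_ineq4[of y k] by (auto simp: T_def)
    have "(- c * W (x + h) (y + k) - d * Q (x + h) (y + k)) + (- c * W (x - h) (y - k) - d * Q (x - h) (y - k))
       \<le> 2 * (- c * W x y - d * Q x y)"
    proof (rule has_integral_le)
      show "((\<lambda>t. t powr (p - 3) * zigzag_block t (x + h) (y + k) + t powr (p - 3) * zigzag_block t (x - h) (y - k))
        has_integral (- c * W (x + h) (y + k) - d * Q (x + h) (y + k)) + (- c * W (x - h) (y - k) - d * Q (x - h) (y - k))) {0..T}"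
        by (intro has_integral_add I T)
      show "((\<lambda>t. 2 * (t powr (p - 3) * zigzag_block t x y)) has_integral 2 * (- c * W x y - d * Q x y)) {0..T}"
        by (intro has_integral_mult_right I T)
      fix t assume "t \<in> {0..T}"
      then have "zigzag_block t (x + h) (y + k) + zigzag_block t (x - h) (y - k) \<le> 2 * zigzag_block t x y"
        using zigzag_concave_block[of t, where 'a='a] hk unfolding zigzag_concave_def by auto
      then have "t powr (p - 3) * (zigzag_block t (x + h) (y + k) + zigzag_block t (x - h) (y - k))
        \<le> t powr (p - 3) * (2 * zigzag_block t x y)" by (rule mult_left_mono) auto
      then show "t powr (p - 3) * zigzag_block t (x + h) (y + k) + t powr (p - 3) * zigzag_block t (x - h) (y - k)
         \<le> 2 * (t powr (p - 3) * zigzag_block t x y)" by (simp add: algebra_simps)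
    qed
    then have "c * (2 * W x y) \<le> c * (W (x + h) (y + k) + W (x - h) (y - k)) 
        - d * (2 * Q x y - Q (x + h) (y + k) - Q (x - h) (y - k))"
      by (simp add: algebra_simps)
    moreover have "0 \<le> d * (2 * Q x y - Q (x + h) (y + k) - Q (x - h) (y - k))" using d Q by simp
    ultimately have "c * (2 * W x y) \<le> c * (W (x + h) (y + k) + W (x - h) (y - k))" by linarith
    then show ?thesis using c by simp
  qed
  then show "- burk_W p (norm (x + h)) (norm (y + k)) + - burk_W p (norm (x - h)) (norm (y - k))
     \<le> 2 * - burk_W p (norm x) (norm y)" by (simp add: W_def)
qed

section \<open>The one-variable functions behind the system\<close>

text \<open>The system reads \<open>burk_F p Y = \<rho> * burk_F p \<gamma>\<close> and \<open>burk_M p Y = \<theta> * burk_M p \<gamma>\<close>.\<close>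

definition burk_F :: "real \<Rightarrow> real \<Rightarrow> real" where
  "burk_F p t = (1 - (p - 1) * t) * (1 + t) powr (p - 1)"

definition burk_M :: "real \<Rightarrow> real \<Rightarrow> real" where
  "burk_M p t = t * (1 + t) powr (p - 2)"

text \<open>
  \<open>burk_kappa\<close> and \<open>burk_C\<close> are determined by requiring that
  \<open>burk_C p g - burk_kappa p g / (p - 1) * burk_F p s\<close> touch \<open>s powr p\<close> to first order at \<open>s = g\<close>.
\<close>

definition burk_kappa :: "real \<Rightarrow> real \<Rightarrow> real" where
  "burk_kappa p g = (g / (1 + g)) powr (p - 2)"

definition burk_C :: "real \<Rightarrow> real \<Rightarrow> real" where
  "burk_C p g = g powr (p - 2) * (1 + (2 - p) * g) / (p - 1)"

lemma burk_W_eq_burk_F: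
  assumes "0 < r" "0 \<le> s"
  shows "burk_W p r s = r powr p * burk_F p (s / r)"
proof -
  have "(r + s) powr (p - 1) = (r * (1 + s / r)) powr (p - 1)"
    using assms by (simp add: distrib_left)
  also have "\<dots> = r powr (p - 1) * (1 + s / r) powr (p - 1)"
    using assms by (simp add: powr_mult)
  also have "r powr (p - 1) = r powr p / r" using assms by (simp add: powr_diff)
  finally have 1: "(r + s) powr (p - 1) = r powr p / r * (1 + s / r) powr (p - 1)" .
  have 2: "1 - (p - 1) * (s / r) = (r - (p - 1) * s) / r" using assms by (simp add: field_simps)
  show ?thesis unfolding burk_W_def burk_F_def 1 2 by simp
qed

text \<open>This ties the two equations of the system together: differentiating
  \<open>burk_F p Y = \<rho> * burk_F p \<gamma>\<close> expresses the slope of \<gamma> in Y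
  through \<open>burk_M\<close>, and the second equation prescribes that slope.\<close>

lemma has_real_derivative_burk_F:
  assumes "-1 < t"
  shows "(burk_F p has_real_derivative - (p * (p - 1) * burk_M p t)) (at t)"
proof -
  have "(burk_F p has_real_derivative - (p - 1) * (1 + t) powr (p - 1)
      + (1 - (p - 1) * t) * ((p - 1) * (1 + t) powr (p - 1 - 1))) (at t)"
    unfolding burk_F_def [abs_def] using assms
    by (auto intro!: derivative_eq_intros DERIV_fun_powr[where r = "p - 1", THEN DERIV_cong])
  moreover have "(1 + t) powr (p - 1) = (1 + t) powr (p - 2) * (1 + t)"
    using assms by (simp add: powr_diff power2_eq_square)
  ultimately show ?thesis
    by (simp add: burk_M_def algebra_simps)
qed

lemma continuous_on_burk_F: "continuous_on {0..} (burk_F p)"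
  by (intro continuous_at_imp_continuous_on ballI DERIV_isCont[OF has_real_derivative_burk_F]) auto

lemma burk_M_pos: "0 < t \<Longrightarrow> 0 < burk_M p t"
  and burk_M_0 [simp]: "burk_M p 0 = 0"
  by (simp_all add: burk_M_def)

lemma burk_M_nonneg: "0 \<le> t \<Longrightarrow> 0 \<le> burk_M p t"
  by (simp add: burk_M_def)

lemma burk_F_0 [simp]: "burk_F p 0 = 1"
  by (simp add: burk_F_def)

lemma burk_F_inverse [simp]: "1 < p \<Longrightarrow> burk_F p (1 / (p - 1)) = 0"
  by (simp add: burk_F_def)

lemma burk_F_strict_decreasing:
  assumes "1 < p" "0 \<le> t" "t < u"
  shows "burk_F p u < burk_F p t"
proof (rule DERIV_neg_imp_decreasing_open[where f = "burk_F p"])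
  fix x assume "t < x" "x < u"
  then show "\<exists>y. (burk_F p has_real_derivative y) (at x) \<and> y < 0"
    using assms has_real_derivative_burk_F[of x p] burk_M_pos[of x p]
    by (intro exI[of _ "- (p * (p - 1) * burk_M p x)"]) auto
qed (use assms in \<open>auto intro: continuous_on_subset[OF continuous_on_burk_F]\<close>)

lemma burk_F_le_iff:
  assumes "1 < p" "0 \<le> t" "0 \<le> u"
  shows "burk_F p u \<le> burk_F p t \<longleftrightarrow> t \<le> u"
  using burk_F_strict_decreasing[of p t u] burk_F_strict_decreasing[of p u t] assms
  by (cases t u rule: linorder_cases) auto

text \<open>The factor \<open>(1 + t) powr (p - 2)\<close> decreases for p < 2. Written as t / (1 +
  t) times \<open>(1 + t) powr (p - 1)\<close>, the function becomes a product of nonnegative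
  increasing factors.\<close>

lemma burk_M_mono:
  assumes "1 < p" "0 \<le> t" "t \<le> u"
  shows "burk_M p t \<le> burk_M p u"
proof -
  have eq: "burk_M p x = x / (1 + x) * (1 + x) powr (p - 1)" if "0 \<le> x" for x
    using that by (simp add: burk_M_def powr_diff power2_eq_square field_simps)
  have "t / (1 + t) \<le> u / (1 + u)" using assms by (simp add: field_simps)
  moreover have "(1 + t) powr (p - 1) \<le> (1 + u) powr (p - 1)" using assms by (intro powr_mono2) auto
  ultimately show ?thesis using assms by (simp only: eq) (intro mult_mono, auto)
qed

text \<open>The difference \<open>d\<close> of the two sides has derivative \<open>p * s * (1 + s)
  powr (p - 2) * (burk_kappa p g - burk_kappa p s)\<close>. Since \<open>burk_kappa p\<close> is
  nonincreasing, \<open>d\<close> falls up to g and rises afterwards; its value at g is 0 by the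
  choice of \<open>burk_C\<close>.\<close>

lemma burk_majorization:
  assumes p: "1 < p" "p \<le> 2" and g: "0 < g"
  shows "0 \<le> s \<Longrightarrow> s powr p \<le> burk_C p g - burk_kappa p g / (p - 1) * burk_F p s"
    and "g powr p = burk_C p g - burk_kappa p g / (p - 1) * burk_F p g"
proof -
  define d where "d s = burk_C p g - burk_kappa p g / (p - 1) * burk_F p s - s powr p" for s
  have deriv: "(d has_real_derivative p * s * (1 + s) powr (p - 2) * (burk_kappa p g - burk_kappa p s)) (at s)"
    if "0 < s" for s
  proof -
    have "(d has_real_derivative - (burk_kappa p g / (p - 1) * - (p * (p - 1) * burk_M p s)) - p * s powr (p - 1)) (at s)"
    proof -
      have "((\<lambda>s. burk_C p g) has_real_derivative 0) (at s)" by simp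
      moreover have "((\<lambda>s. burk_kappa p g / (p - 1) * burk_F p s) has_real_derivative
          burk_kappa p g / (p - 1) * - (p * (p - 1) * burk_M p s)) (at s)"
        using that by (intro DERIV_cmult has_real_derivative_burk_F) auto
      moreover have "((\<lambda>s. s powr p) has_real_derivative p * s powr (p - 1)) (at s)"
        using that by (rule has_real_derivative_powr)
      ultimately have "(d has_real_derivative 0 - burk_kappa p g / (p - 1) * - (p * (p - 1) * burk_M p s) - p * s powr (p - 1)) (at s)"
        unfolding d_def [abs_def] by (intro DERIV_diff)
      then show ?thesis by simp
    qed
    moreover have "s powr (p - 1) = s * (1 + s) powr (p - 2) * burk_kappa p s"
      using that by (simp add: burk_kappa_def powr_divide powr_diff power2_eq_square)
    moreover have "burk_kappa p g / (p - 1) * - (p * (p - 1) * burk_M p s) = - (burk_kappa p g * (p * burk_M p s))"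
      using p by simp
    ultimately show ?thesis
      by (elim DERIV_cong) (simp only: burk_M_def, simp add: algebra_simps)
  qed
  have kappa_mono: "burk_kappa p u \<le> burk_kappa p t" if "0 < t" "t \<le> u" for t u
    unfolding burk_kappa_def using p that by (intro powr_mono2') (auto simp: field_simps)
  have cont: "continuous_on {a..b} d" if "0 \<le> a" for a b
    unfolding d_def [abs_def] using that p
    by (intro continuous_intros continuous_on_powr' continuous_on_subset[OF continuous_on_burk_F]) auto
  have "d g \<le> d s" if s: "0 \<le> s" for s
  proof (cases "s \<le> g")
    case True
    show ?thesis
    proof (rule DERIV_nonpos_imp_decreasing_open[OF True _ cont[OF s]])
      fix x assume "s < x" "x < g"
      then show "\<exists>y. (d has_real_derivative y) (at x) \<and> y \<le> 0"
        using deriv[of x] kappa_mono[of x g] s p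
        by (intro exI[of _ "p * x * (1 + x) powr (p - 2) * (burk_kappa p g - burk_kappa p x)"] conjI) (auto intro!: mult_nonneg_nonpos)
    qed
  next
    case False
    show ?thesis
    proof (rule DERIV_nonneg_imp_increasing_open[OF _ _ cont])
      fix x assume "g < x" "x < s"
      then show "\<exists>y. (d has_real_derivative y) (at x) \<and> 0 \<le> y"
        using deriv[of x] kappa_mono[of g x] g p
        by (intro exI[of _ "p * x * (1 + x) powr (p - 2) * (burk_kappa p g - burk_kappa p x)"] conjI) (auto intro!: mult_nonneg_nonneg)
    qed (use False g in auto)
  qed
  moreover have "d g = 0"
  proof -
    have "burk_kappa p g * (1 + g) powr (p - 1) = g powr (p - 2) * (1 + g)"
    proof -
      have "burk_kappa p g = g powr (p - 2) / (1 + g) powr (p - 2)"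
        using g by (simp add: burk_kappa_def powr_divide)
      moreover have "(1 + g) powr (p - 1) = (1 + g) powr (p - 2) * (1 + g)"
        using g by (simp add: powr_diff power2_eq_square)
      ultimately show ?thesis using g by simp
    qed
    then have "burk_kappa p g * burk_F p g = g powr (p - 2) * ((1 + g) * (1 - (p - 1) * g))"
      by (simp add: burk_F_def algebra_simps)
    moreover have "g powr p = g powr (p - 2) * g\<^sup>2" using g by (simp add: powr_diff power2_eq_square)
    ultimately
    have "(p - 1) * d g = g powr (p - 2) * ((1 + (2 - p) * g) - (1 + g) * (1 - (p - 1) * g) - (p - 1) * g\<^sup>2)"
    proof -
      have "(p - 1) * burk_C p g = g powr (p - 2) * (1 + (2 - p) * g)"
        "(p - 1) * (burk_kappa p g / (p - 1) * burk_F p g) = burk_kappa p g * burk_F p g"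
        using p by (simp_all add: burk_C_def)
      then have "(p - 1) * d g = g powr (p - 2) * (1 + (2 - p) * g) - burk_kappa p g * burk_F p g - (p - 1) * g powr p"
        unfolding d_def right_diff_distrib by simp
      then show ?thesis
        using \<open>burk_kappa p g * burk_F p g = _\<close> \<open>g powr p = _\<close> by (simp add: algebra_simps)
    qed
    also have "(1 + (2 - p) * g) - (1 + g) * (1 - (p - 1) * g) - (p - 1) * g\<^sup>2 = 0" by (simp add: algebra_simps power2_eq_square)
    finally show ?thesis using p by simp
  qed
  ultimately have nonneg: "\<And>s. 0 \<le> s \<Longrightarrow> 0 \<le> d s" and dg: "d g = 0" by auto
  show "0 \<le> s \<Longrightarrow> s powr p \<le> burk_C p g - burk_kappa p g / (p - 1) * burk_F p s"
    and "g powr p = burk_C p g - burk_kappa p g / (p - 1) * burk_F p g"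
    using nonneg[of s] dg by (auto simp: d_def)
qed

text \<open>The majorization is evaluated at the zero 1 / (p - 1) of \<open>burk_F p\<close>, where
  the term with \<open>burk_kappa\<close> disappears. Together with the next lemma this identifies
  the best constant as the minimum of \<open>burk_C p\<close> over positive g.\<close>

lemma burk_C_ge:
  assumes "1 < p" "p \<le> 2" "0 < g"
  shows "(1 / (p - 1)) powr p \<le> burk_C p g"
  using burk_majorization(1)[of p g "1 / (p - 1)"] assms by simp

lemma burk_C_inverse:
  assumes "1 < p" "p \<le> 2"
  shows "burk_C p (1 / (p - 1)) = (1 / (p - 1)) powr p"
  using burk_majorization(2)[of p "1 / (p - 1)"] assms by simp

text \<open>Along a line of slope m in [0, 1] above the diagonal, the quotient of
  \<open>burk_M\<close> at the abscissa by \<open>burk_M\<close> at the ordinate increases strictly.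
  Indeed \<open>burk_M p t\<close> is \<open>t powr (p - 1) * (t / (1 + t)) powr (2 - p)\<close>,
  and the corresponding quotients increase for t and for t / (1 + t) separately. Strictness comes
  from the first factor, as 2 - p may be 0.\<close>

lemma burk_M_ratio:
  assumes p: "1 < p" "p \<le> 2" and Y: "0 < Y0" "Y0 < Y1" and m: "0 \<le> m" "m \<le> 1"
    and l: "l1 = l0 + m * (Y1 - Y0)" "Y0 < l0" "Y1 \<le> l1"
  shows "burk_M p Y0 * burk_M p l1 < burk_M p Y1 * burk_M p l0"
proof -
  have eq: "burk_M p t = t powr (p - 1) * (t / (1 + t)) powr (2 - p)" if "0 < t" for t
  proof -
    have "(t / (1 + t)) powr (2 - p) = t powr (2 - p) * (1 + t) powr (p - 2)"
      using that by (simp add: powr_divide powr_diff field_simps)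
    then show ?thesis using that by (simp add: burk_M_def flip: powr_add mult.assoc)
  qed
  have pos: "0 < l0" "0 < l1" "0 < Y1" using Y l by auto
  have "m * Y0 \<le> 1 * Y0" using m Y by (intro mult_right_mono) auto
  then have "m * Y0 < l0" using l by simp
  then have "m * Y0 * (Y1 - Y0) < l0 * (Y1 - Y0)" using Y by simp
  then have 1: "Y0 * l1 < Y1 * l0" by (simp add: l algebra_simps)
  have "l0 \<le> l1" "l1 - l0 \<le> Y1 - Y0"
    using m Y mult_right_mono[of m 1 "Y1 - Y0"] by (auto simp: l)
  \<comment> \<open>This controls the extra terms by which the cross-multiplied comparison for t /
    (1 + t) differs from the one for t.\<close>
  then have "Y0 * Y1 * (l1 - l0) \<le> l0 * l1 * (Y1 - Y0)"
    using l Y pos by (intro mult_mono) auto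
  then have "Y0 * (1 + Y1) * (l1 * (1 + l0)) \<le> Y1 * (1 + Y0) * (l0 * (1 + l1))"
    using 1 by (simp add: algebra_simps)
  then have "Y0 * l1 * ((1 + Y1) * (1 + l0)) \<le> Y1 * l0 * ((1 + Y0) * (1 + l1))"
    by (simp add: mult_ac)
  moreover have "a / b \<le> c / d" if "a * d \<le> c * b" "0 < b" "0 < d" for a b c d :: real
    using that by (simp add: field_simps)
  ultimately have "(Y0 * l1) / ((1 + Y0) * (1 + l1)) \<le> (Y1 * l0) / ((1 + Y1) * (1 + l0))"
    using Y pos by simp
  then have 2: "Y0 / (1 + Y0) * (l1 / (1 + l1)) \<le> Y1 / (1 + Y1) * (l0 / (1 + l0))"
    by simp
  define a where "a t = t / (1 + t)" for t :: real
  have a: "0 < a Y0" "0 < a Y1" "0 < a l0" "0 < a l1" using Y pos by (auto simp: a_def)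
  have "burk_M p Y0 * burk_M p l1 = (Y0 * l1) powr (p - 1) * (a Y0 * a l1) powr (2 - p)"
    using Y pos a by (simp add: eq powr_mult flip: a_def)
  also have "\<dots> \<le> (Y0 * l1) powr (p - 1) * (a Y1 * a l0) powr (2 - p)"
    using 2[folded a_def] p a by (intro mult_left_mono powr_mono2) auto
  also have "\<dots> < (Y1 * l0) powr (p - 1) * (a Y1 * a l0) powr (2 - p)"
    using 1 p Y pos a by (intro mult_strict_right_mono powr_less_mono2) auto
  also have "\<dots> = burk_M p Y1 * burk_M p l0"
    using Y pos a by (simp add: eq powr_mult flip: a_def)
  finally show ?thesis .
qed

text \<open>
  The first equation of the system defines \<open>\<gamma>\<close> implicitly as a function of \<open>Y\<close>, with slope \<open>\<theta> / \<rho>\<close> at the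
  solution. Since \<open>burk_F p\<close> decreases, the second inequality says that its graph lies above the tangent.
\<close>

lemma burk_F_tangent:
  assumes p: "1 < p" "p \<le> 2" and Y0: "0 \<le> Y0" "Y0 < g" and \<rho>: "1 < \<rho>" and \<theta>: "0 \<le> \<theta>" "\<theta> < 1"
    and F: "burk_F p Y0 = \<rho> * burk_F p g" and M: "burk_M p Y0 = \<theta> * burk_M p g"
    and Y: "0 \<le> Y"
  shows "0 < g + \<theta> / \<rho> * (Y - Y0)" and "burk_F p Y \<le> \<rho> * burk_F p (g + \<theta> / \<rho> * (Y - Y0))"
proof -
  define m where "m = \<theta> / \<rho>"
  define l where "l t = g + m * (t - Y0)" for t
  have m: "0 \<le> m" "m \<le> 1" using \<rho> \<theta> by (auto simp: m_def field_simps)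
  have lpos: "0 < l t" if "0 \<le> t" for t
  proof -
    have "m * Y0 \<le> 1 * Y0" using m Y0 by (intro mult_right_mono) auto
    moreover have "0 \<le> m * t" using m that by simp
    ultimately show ?thesis using Y0 by (simp add: l_def algebra_simps)
  qed
  have Mg: "0 < burk_M p g" using Y0 by (intro burk_M_pos) auto
  \<comment> \<open>The second equation makes Y0 a critical point of \<open>D\<close>. The bounds
    \<open>left\<close> and \<open>right\<close> below show that the derivative changes sign there
    from minus to plus, so \<open>D\<close> is minimal at Y0, where it vanishes by the first
    equation.\<close>
  define D where "D t = \<rho> * burk_F p (l t) - burk_F p t" for t
  have deriv: "(D has_real_derivative p * (p - 1) * (burk_M p t - \<theta> * burk_M p (l t))) (at t)" if t: "0 \<le> t" for t
  proof -
    have "((\<lambda>t. burk_F p (l t)) has_real_derivative - (p * (p - 1) * burk_M p (l t)) * m) (at t)"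
      by (rule DERIV_chain'[of l m t UNIV "burk_F p"])
         (use lpos[OF t] in \<open>auto simp: l_def [abs_def] intro!: derivative_eq_intros has_real_derivative_burk_F\<close>)
    then have "(D has_real_derivative \<rho> * (- (p * (p - 1) * burk_M p (l t)) * m) - - (p * (p - 1) * burk_M p t)) (at t)"
      unfolding D_def [abs_def] using t
      by (intro DERIV_diff DERIV_cmult has_real_derivative_burk_F) auto
    then show ?thesis using \<rho> by (simp add: m_def algebra_simps)
  qed
  have cont: "continuous_on {a..b} D" if "0 \<le> a" for a b
    using that by (intro continuous_at_imp_continuous_on ballI DERIV_isCont[OF deriv]) auto
  \<comment> \<open>\<open>burk_M_ratio\<close> applies when Y0 > 0 and the line is still above the
    diagonal at t. If \<open>\<theta> = 0\<close> the claim is trivial, and once the line has met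
    the diagonal, \<theta> < 1 and monotonicity of \<open>burk_M\<close> suffice.\<close>
  have right: "\<theta> * burk_M p (l t) \<le> burk_M p t" if t: "Y0 < t" for t
  proof (cases "\<theta> = 0 \<or> l t \<le> t")
    case True
    have "\<theta> * burk_M p (l t) \<le> 1 * burk_M p (l t)" if "l t \<le> t"
      using \<theta> lpos[of t] Y0 t by (intro mult_right_mono burk_M_nonneg) auto
    then show ?thesis
      using True burk_M_mono[of p "l t" t] p lpos[of t] Y0 t burk_M_nonneg[of t p] by auto
  next
    case False
    then have "0 < Y0" using Mg M Y0 by (cases "Y0 = 0") auto
    then have "burk_M p Y0 * burk_M p (l t) < burk_M p t * burk_M p g"
      using p t m Y0 False by (intro burk_M_ratio[of p Y0 t m]) (auto simp: l_def)
    then have "burk_M p g * (\<theta> * burk_M p (l t)) < burk_M p g * burk_M p t"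
      by (simp add: M mult_ac)
    then show ?thesis using Mg by simp
  qed
  have left: "burk_M p t \<le> \<theta> * burk_M p (l t)" if t: "0 < t" "t < Y0" for t
  proof -
    have "m * (Y0 - t) \<le> 1 * (Y0 - t)" using m t by (intro mult_right_mono) auto
    then have "t < l t" using Y0 by (simp add: l_def algebra_simps)
    then have "burk_M p t * burk_M p g < burk_M p Y0 * burk_M p (l t)"
      using p t m Y0 by (intro burk_M_ratio[of p t Y0 m]) (auto simp: l_def algebra_simps)
    then have "burk_M p g * burk_M p t < burk_M p g * (\<theta> * burk_M p (l t))"
      by (simp add: M mult_ac)
    then show ?thesis using Mg by simp
  qed
  have "D Y0 \<le> D Y"
  proof (cases "Y \<le> Y0")
    case True
    show ?thesis
    proof (rule DERIV_nonpos_imp_decreasing_open[OF True _ cont[OF Y]])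
      fix x assume "Y < x" "x < Y0"
      then show "\<exists>y. (D has_real_derivative y) (at x) \<and> y \<le> 0"
        using deriv[of x] left[of x] Y p
        by (intro exI[of _ "p * (p - 1) * (burk_M p x - \<theta> * burk_M p (l x))"] conjI) (auto intro!: mult_nonneg_nonpos)
    qed
  next
    case False
    show ?thesis
    proof (rule DERIV_nonneg_imp_increasing_open[OF _ _ cont])
      fix x assume "Y0 < x" "x < Y"
      then show "\<exists>y. (D has_real_derivative y) (at x) \<and> 0 \<le> y"
        using deriv[of x] right[of x] Y0 p
        by (intro exI[of _ "p * (p - 1) * (burk_M p x - \<theta> * burk_M p (l x))"] conjI) (auto intro!: mult_nonneg_nonneg)
    qed (use False Y0 in auto)
  qed
  moreover have "D Y0 = 0" by (simp add: D_def l_def F)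
  ultimately show "burk_F p Y \<le> \<rho> * burk_F p (g + \<theta> / \<rho> * (Y - Y0))"
    by (simp add: D_def l_def m_def)
  show "0 < g + \<theta> / \<rho> * (Y - Y0)" using lpos[OF Y] by (simp add: l_def m_def)
qed

text \<open>On [0, 1 / (p - 1)] the function \<open>burk_F p\<close> is a decreasing bijection onto
  [0, 1], so the first equation gives \<gamma> as a continuous function \<open>g\<close> of Y. The
  second one is then solved by the intermediate value theorem.\<close>

lemma burk_system_exists:
  assumes p: "1 < p" "p \<le> 2" and \<rho>: "1 < \<rho>" and \<theta>: "0 \<le> \<theta>" "\<theta> < 1"
  obtains g Y where "0 \<le> Y" "Y < g" "g < 1 / (p - 1)"
    "burk_F p Y = \<rho> * burk_F p g" "burk_M p Y = \<theta> * burk_M p g"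
proof -
  define K where "K = 1 / (p - 1)"
  have K: "0 < K" "burk_F p K = 0" using p by (auto simp: K_def)
  have F01: "burk_F p t \<in> {0..1}" if "t \<in> {0..K}" for t
    using that burk_F_le_iff[of p 0 t] burk_F_le_iff[of p t K] p K by auto
  have inj: "inj_on (burk_F p) {0..K}"
    by (rule inj_onI) (metis atLeastAtMost_iff burk_F_le_iff order_antisym order_refl p(1))
  have cont: "continuous_on {0..K} (burk_F p)"
    by (rule continuous_on_subset[OF continuous_on_burk_F]) auto
  have img: "burk_F p ` {0..K} = {0..1}"
  proof (intro antisym subsetI)
    fix v :: real assume "v \<in> {0..1}"
    then have "\<exists>t\<ge>0. t \<le> K \<and> burk_F p t = v"
      using K cont by (intro IVT2') auto
    then show "v \<in> burk_F p ` {0..K}" by auto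
  qed (use F01 in auto)
  define G where "G = the_inv_into {0..K} (burk_F p)"
  have contG: "continuous_on {0..1} G"
    unfolding G_def img[symmetric]
    by (rule continuous_on_inv) (auto simp: cont the_inv_into_f_f inj)
  have G: "G v \<in> {0..K}" "burk_F p (G v) = v" if "v \<in> {0..1}" for v
    using that the_inv_into_into[OF inj, of v "{0..K}"] f_the_inv_into_f[OF inj, of v]
    by (auto simp: G_def img)
  define g where "g Y = G (burk_F p Y / \<rho>)" for Y
  have in01: "burk_F p Y / \<rho> \<in> {0..1}" if "Y \<in> {0..K}" for Y
    using F01[OF that] \<rho> by (auto simp: field_simps)
  have contg: "continuous_on {0..K} g"
    unfolding g_def
    by (rule continuous_on_compose2[OF contG]) (use \<rho> in01 in \<open>auto intro!: continuous_intros cont\<close>)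
  have gK: "g K = K"
    using inj_onD[OF inj, of "G 0" K] G[of 0] K by (simp add: g_def)
  define Q where "Q Y = burk_M p Y - \<theta> * burk_M p (g Y)" for Y
  have g_in: "g Y \<in> {0..K}" if "Y \<in> {0..K}" for Y
    unfolding g_def by (rule G(1)[OF in01[OF that]])
  have contQ: "continuous_on {0..K} Q"
    unfolding Q_def burk_M_def using contg g_in
    by (intro continuous_intros) (auto simp: add_nonneg_eq_0_iff intro: order.trans)
  have "\<exists>Y\<ge>0. Y \<le> K \<and> Q Y = 0"
  proof (rule IVT')
    show "Q 0 \<le> 0" using \<theta> g_in[of 0] K by (auto simp: Q_def burk_M_nonneg)
    show "0 \<le> Q K" using \<theta> K burk_M_nonneg[of K p] by (simp add: Q_def gK mult_le_cancel_right2 mult_left_le_one_le)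
  qed (use K contQ in auto)
  then obtain Y where Y: "0 \<le> Y" "Y \<le> K" "Q Y = 0" by blast
  \<comment> \<open>At K the first equation degenerates to 0 = 0 with g K = K; the second excludes
    this endpoint because \<theta> < 1.\<close>
  have "Y \<noteq> K"
  proof
    assume "Y = K"
    then have "(1 - \<theta>) * burk_M p K = 0" using Y by (simp add: Q_def gK algebra_simps)
    then show False using \<theta> burk_M_pos[of K p] K by simp
  qed
  then have YK: "Y < K" using Y by simp
  have Fg: "burk_F p (g Y) = burk_F p Y / \<rho>"
    unfolding g_def using G(2) in01 Y by simp
  have gY: "0 \<le> g Y" "g Y \<le> K" using g_in[of Y] Y by auto
  have FY: "0 < burk_F p Y" using burk_F_strict_decreasing[of p Y K] p Y YK K by simp
  have "burk_F p (g Y) < burk_F p Y" using FY \<rho> by (simp add: Fg field_simps)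
  then have 1: "Y < g Y" using burk_F_le_iff[of p "g Y" Y] gY Y p by (auto simp: not_le[symmetric])
  have "0 < burk_F p (g Y)" using FY \<rho> by (simp add: Fg)
  then have 2: "g Y < K" using gY K by (auto simp: less_le)
  show thesis
    by (rule that[of Y "g Y"]) (use 1 2 Y Fg \<rho> in \<open>auto simp: K_def Q_def\<close>)
qed

text \<open>Each solution lies on or above the tangent at the other, and both tangents have slope
  \<open>\<theta> / \<rho>\<close>, so the two solutions lie on one line. Along it the quotient in
  \<open>burk_M_ratio\<close> is strictly increasing, hence takes the value \<theta> only
  once.\<close>

lemma burk_system_unique:
  assumes p: "1 < p" "p \<le> 2" and \<rho>: "1 < \<rho>" and \<theta>: "0 \<le> \<theta>" "\<theta> < 1"
    and 1: "0 \<le> Y1" "Y1 < g1" "burk_F p Y1 = \<rho> * burk_F p g1" "burk_M p Y1 = \<theta> * burk_M p g1"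
    and 2: "0 \<le> Y2" "Y2 < g2" "burk_F p Y2 = \<rho> * burk_F p g2" "burk_M p Y2 = \<theta> * burk_M p g2"
  shows "g1 = g2 \<and> Y1 = Y2"
proof -
  have le: "g + \<theta> / \<rho> * (Y' - Y) \<le> g'"
    if "0 \<le> Y" "Y < g" "burk_F p Y = \<rho> * burk_F p g" "burk_M p Y = \<theta> * burk_M p g"
      "0 \<le> Y'" "Y' < g'" "burk_F p Y' = \<rho> * burk_F p g'" for Y g Y' g'
  proof -
    have "burk_F p g' \<le> burk_F p (g + \<theta> / \<rho> * (Y' - Y))" "0 < g + \<theta> / \<rho> * (Y' - Y)"
      using burk_F_tangent[OF p that(1,2) \<rho> \<theta> that(3,4,5)] that \<rho> by auto
    then show ?thesis using burk_F_le_iff[of p "g + \<theta> / \<rho> * (Y' - Y)" g'] that p by auto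
  qed
  have l: "g2 = g1 + \<theta> / \<rho> * (Y2 - Y1)"
    using le[OF 1 2(1-3)] le[OF 2 1(1-3)] minus_diff_eq[of Y2 Y1] mult_minus_right[of "\<theta> / \<rho>" "Y2 - Y1"]
    by simp
  have no: "\<not> Y < Y'"
    if "g' = g + \<theta> / \<rho> * (Y' - Y)" "0 \<le> Y" "Y < g" "burk_M p Y = \<theta> * burk_M p g"
      "0 \<le> Y'" "Y' < g'" "burk_M p Y' = \<theta> * burk_M p g'" for Y g Y' g'
  proof
    assume less: "Y < Y'"
    have M: "0 < burk_M p g" "0 < burk_M p Y'" using that(2,3,5) less by (auto intro!: burk_M_pos)
    have "Y \<noteq> 0"
    proof
      assume "Y = 0"
      then have "\<theta> = 0" using M that(4) by simp
      then show False using M that(7) by simp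
    qed
    then have "burk_M p Y * burk_M p g' < burk_M p Y' * burk_M p g"
      using that less p \<rho> \<theta> by (intro burk_M_ratio[of p Y Y' "\<theta> / \<rho>"]) auto
    then show False using that by simp
  qed
  have "g1 = g2 + \<theta> / \<rho> * (Y1 - Y2)"
    using l minus_diff_eq[of Y2 Y1] mult_minus_right[of "\<theta> / \<rho>" "Y2 - Y1"] by simp
  then have "Y1 = Y2"
    using no[OF l 1(1,2,4) 2(1,2,4)] no[OF _ 2(1,2,4) 1(1,2,4)] by (meson linorder_neqE)
  with l show ?thesis by simp
qed

section \<open>Burkholder functions on the Hilbert space\<close>

definition burk_Psi :: "real \<Rightarrow> real \<Rightarrow> 'a::real_inner \<Rightarrow> 'a \<Rightarrow> real" where
  "burk_Psi p g x y = - (burk_kappa p g / (p - 1) * burk_W p (norm x) (norm y))"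

text \<open>For |y| >= |x| / (p - 1) the obstacle itself is kept, since \<open>burk_Psi\<close> in
  general exceeds it there. The first case in the definition of \<open>cal_B\<close> leads to
  vectors y in this region.\<close>

definition burk_phi :: "real \<Rightarrow> 'a::real_inner \<Rightarrow> 'a \<Rightarrow> real" where
  "burk_phi p x y =
     (if norm x / (p - 1) \<le> norm y then norm y powr p - (1 / (p - 1)) powr p * norm x powr p
      else burk_Psi p (1 / (p - 1)) x y)"

lemma zigzag_concave_burk_Psi:
  assumes p: "1 < p" "p \<le> 2"
  shows "zigzag_concave (burk_Psi p g :: 'a::real_inner \<Rightarrow> 'a \<Rightarrow> real)"
  unfolding zigzag_concave_def
proof (intro allI impI)
  fix x y h k :: 'a
  assume "norm k \<le> norm h"
  then have "- burk_W p (norm (x + h)) (norm (y + k)) + - burk_W p (norm (x - h)) (norm (y - k))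
      \<le> 2 * - burk_W p (norm x) (norm y)"
    using zigzag_concave_burk_W[OF p, where 'a='a] unfolding zigzag_concave_def by blast
  moreover have "0 \<le> burk_kappa p g / (p - 1)" using p by (simp add: burk_kappa_def)
  ultimately have "burk_kappa p g / (p - 1) * (- burk_W p (norm (x + h)) (norm (y + k)) + - burk_W p (norm (x - h)) (norm (y - k)))
      \<le> burk_kappa p g / (p - 1) * (2 * - burk_W p (norm x) (norm y))"
    by (rule mult_left_mono)
  then show "burk_Psi p g (x + h) (y + k) + burk_Psi p g (x - h) (y - k) \<le> 2 * burk_Psi p g x y"
    unfolding burk_Psi_def distrib_left mult.left_commute[of _ 2] by simp
qed

text \<open>By homogeneity this is \<open>burk_majorization\<close> at s = |y| / |x|. For x = 0 it
  reduces to \<open>1 \<le> burk_kappa p g\<close>, a nonpositive power of a number below 1.\<close>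

lemma burk_Psi_ge:
  fixes x y :: "'a::real_inner"
  assumes p: "1 < p" "p \<le> 2" and g: "0 < g"
  shows "norm y powr p - burk_C p g * norm x powr p \<le> burk_Psi p g x y"
proof (cases "x = 0")
  case True
  have "1 \<le> burk_kappa p g"
    unfolding burk_kappa_def using powr_mono2'[of "p - 2" "g / (1 + g)" 1] p g by simp
  then have "1 * norm y powr p \<le> burk_kappa p g * norm y powr p" by (rule mult_right_mono) simp
  moreover have "burk_Psi p g x y = burk_kappa p g * (norm y * norm y powr (p - 1))"
    using True p by (simp add: burk_Psi_def burk_W_def)
  moreover have "norm y * norm y powr (p - 1) = norm y powr p"
    by (cases "y = 0") (simp_all add: powr_diff)
  ultimately show ?thesis using True p by simp
next
  case False
  define r s where "r = norm x" and "s = norm y"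
  have rs: "0 < r" "0 \<le> s" using False by (auto simp: r_def s_def)
  have "(s / r) powr p \<le> burk_C p g - burk_kappa p g / (p - 1) * burk_F p (s / r)"
    using rs by (intro burk_majorization(1) p g) auto
  then have "r powr p * (s / r) powr p \<le> r powr p * (burk_C p g - burk_kappa p g / (p - 1) * burk_F p (s / r))"
    by (rule mult_left_mono) simp
  moreover have "r powr p * (s / r) powr p = s powr p" using rs by (simp add: powr_divide)
  moreover have "burk_Psi p g x y = - (burk_kappa p g / (p - 1) * (r powr p * burk_F p (s / r)))"
    using rs unfolding burk_Psi_def r_def s_def by (subst burk_W_eq_burk_F) auto
  ultimately show ?thesis
    unfolding r_def s_def by (simp add: algebra_simps)
qed

section \<open>Burkholder's minimal majorant and its zigzag concavity\<close>

lemma burk_phi_ge: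
  fixes x y :: "'a::real_inner"
  assumes p: "1 < p" "p \<le> 2"
  shows "norm y powr p - (1 / (p - 1)) powr p * norm x powr p \<le> burk_phi p x y"
  using burk_Psi_ge[OF p, of "1 / (p - 1)" y x] p burk_C_inverse[OF p]
  by (simp add: burk_phi_def)

lemma burk_phi_le_burk_Psi:
  fixes x y :: "'a::real_inner"
  assumes p: "1 < p" "p \<le> 2"
  shows "burk_phi p x y \<le> burk_Psi p (1 / (p - 1)) x y"
  using burk_Psi_ge[OF p, of "1 / (p - 1)" y x] p burk_C_inverse[OF p]
  by (simp add: burk_phi_def)

lemma burk_phi_eq_burk_Psi:
  fixes x y :: "'a::real_inner"
  assumes p: "1 < p" "p \<le> 2" and le: "norm y \<le> norm x / (p - 1)"
  shows "burk_phi p x y = burk_Psi p (1 / (p - 1)) x y"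
proof (cases "norm y = norm x / (p - 1)")
  case True
  then have "norm x = (p - 1) * norm y" using p by (simp add: field_simps)
  then have "burk_Psi p (1 / (p - 1)) x y = 0" by (simp add: burk_Psi_def burk_W_def)
  moreover have "norm y powr p = (1 / (p - 1)) powr p * norm x powr p"
    unfolding True by (simp add: powr_divide)
  ultimately show ?thesis using True by (simp add: burk_phi_def)
qed (use le in \<open>simp add: burk_phi_def\<close>)

lemma continuous_on_burk_phi:
  assumes p: "1 < p" "p \<le> 2"
  shows "continuous_on UNIV (\<lambda>(x::'a::real_inner, y). burk_phi p x y)"
proof -
  define v where "v z = norm (snd z) powr p - (1 / (p - 1)) powr p * norm (fst z) powr p" for z :: "'a \<times> 'a"
  define \<psi> where "\<psi> z = burk_Psi p (1 / (p - 1)) (fst z) (snd z)" for z :: "'a \<times> 'a"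
  have cont: "continuous_on A v" "continuous_on A \<psi>" for A
    unfolding v_def [abs_def] \<psi>_def [abs_def] burk_Psi_def burk_W_def using p
    by (auto intro!: continuous_intros continuous_on_powr')
  have "continuous_on ({z::'a\<times>'a. norm (fst z) / (p - 1) \<le> norm (snd z)} \<union> {z. norm (snd z) \<le> norm (fst z) / (p - 1)})
    (\<lambda>z. if norm (fst z) / (p - 1) \<le> norm (snd z) then v z else \<psi> z)"
  proof (rule continuous_on_If)
    fix z :: "'a \<times> 'a"
    assume "z \<in> {z. norm (snd z) \<le> norm (fst z) / (p - 1)}" "norm (fst z) / (p - 1) \<le> norm (snd z)"
    then show "v z = \<psi> z"
      using burk_phi_eq_burk_Psi[OF p, of "snd z" "fst z"] by (simp add: burk_phi_def v_def \<psi>_def)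
  qed (use p in \<open>auto intro!: closed_Collect_le continuous_intros cont\<close>)
  moreover have "{z::'a\<times>'a. norm (fst z) / (p - 1) \<le> norm (snd z)} \<union> {z. norm (snd z) \<le> norm (fst z) / (p - 1)} = UNIV"
    by auto
  ultimately show ?thesis
    unfolding burk_phi_def case_prod_unfold v_def \<psi>_def by simp
qed

text \<open>The right-hand side is the tangent at w = s^2 to the concave function
  \<open>w powr (p / 2)\<close>. The bound is Young's inequality with weights p / 2 and 1 - p /
  2.\<close>

lemma powr_le_tangent_in_square:
  fixes p s z :: real
  assumes p: "0 \<le> p" "p \<le> 2" and "0 < s" "0 \<le> z"
  shows "z powr p \<le> s powr p + p / 2 * s powr (p - 2) * (z\<^sup>2 - s\<^sup>2)"
proof -
  have s: "s\<^sup>2 * s powr (p - 2) = s powr p" using assms by (simp add: powr_diff power2_eq_square)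
  show ?thesis
  proof (cases "z = 0")
    case True
    have "p / 2 * s powr p \<le> 1 * s powr p" using p by (intro mult_right_mono) auto
    then show ?thesis using True s by (simp add: algebra_simps)
  next
    case False
    then have z: "0 < z" using assms by simp
    have "(z\<^sup>2) powr (p / 2) * (s\<^sup>2) powr (1 - p / 2) \<le> p / 2 * z\<^sup>2 + (1 - p / 2) * s\<^sup>2"
      using p z assms by (intro Youngs_inequality_0) auto
    moreover have "(z\<^sup>2) powr (p / 2) = z powr p" "(s\<^sup>2) powr (1 - p / 2) = s powr (2 - p)"
      using z assms by (simp_all add: powr_powr flip: powr_numeral)
    ultimately have "z powr p * s powr (2 - p) * s powr (p - 2) \<le> (p / 2 * z\<^sup>2 + (1 - p / 2) * s\<^sup>2) * s powr (p - 2)"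
      by (intro mult_right_mono) auto
    moreover have "s powr (2 - p) * s powr (p - 2) = 1" using assms by (simp flip: powr_add)
    ultimately show ?thesis
      using s by (simp add: field_simps)
  qed
qed

text \<open>On (0, M] the function t^p minus a suitable c t^2 is still convex and nondecreasing, so
  it obeys the midpoint inequality for norms; the parallelogram law evaluates the quadratic part
  exactly. The hypothesis \<open>nz\<close> keeps the norms away from 0, where derivatives fail, and
  x = 0 is computed directly.\<close>

lemma norm_powr_midpoint_gap:
  fixes x h :: "'a::real_inner"
  assumes p: "1 < p" "p \<le> 2" and M: "norm (x + h) \<le> M" "norm (x - h) \<le> M" "0 < M"
    and nz: "x \<noteq> 0 \<Longrightarrow> x + h \<noteq> 0 \<and> x - h \<noteq> 0"
  shows "2 * norm x powr p + p * (p - 1) * M powr (p - 2) * (norm h)\<^sup>2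
    \<le> norm (x + h) powr p + norm (x - h) powr p"
proof (cases "x = 0")
  case True
  show ?thesis
  proof (cases "h = 0")
    case False
    have "M powr (p - 2) \<le> norm h powr (p - 2)"
      using p M True False by (intro powr_mono2') auto
    moreover have "p * (p - 1) \<le> 2 * 1" using p by (intro mult_mono) auto
    ultimately have "p * (p - 1) * M powr (p - 2) \<le> 2 * norm h powr (p - 2)"
      using p by (intro mult_mono) auto
    then have "p * (p - 1) * M powr (p - 2) * (norm h)\<^sup>2 \<le> 2 * norm h powr (p - 2) * (norm h)\<^sup>2"
      by (rule mult_right_mono) simp
    also have "\<dots> = 2 * norm h powr p" using False by (simp add: powr_diff power2_eq_square)
    finally show ?thesis using True by simp
  qed (use True in simp)
next
  case False
  \<comment> \<open>This is the largest coefficient keeping \<open>f\<close> convex: the second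
    derivative of \<open>t powr p\<close> on (0, M] is smallest at M.\<close>
  define c where "c = p * (p - 1) / 2 * M powr (p - 2)"
  define f where "f t = t powr p - c * t\<^sup>2" for t
  have ge: "M powr (p - 2) \<le> t powr (p - 2)" if "t \<in> {0<..M}" for t
    using that p by (intro powr_mono2') auto
  have d1: "(f has_real_derivative p * t powr (p - 1) - 2 * c * t) (at t)" if "t \<in> {0<..M}" for t
    unfolding f_def [abs_def] using that by (auto intro!: derivative_eq_intros has_real_derivative_powr)
  have d2: "((\<lambda>t. p * t powr (p - 1) - 2 * c * t) has_real_derivative p * (p - 1) * (t powr (p - 2) - M powr (p - 2))) (at t)"
    if "t \<in> {0<..M}" for t
  proof -
    have "((\<lambda>t. p * t powr (p - 1) - 2 * c * t) has_real_derivative p * ((p - 1) * t powr (p - 1 - 1)) - 2 * c * 1) (at t)"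
      using that by (intro DERIV_diff DERIV_cmult has_real_derivative_powr DERIV_ident) auto
    moreover have "2 * c = p * (p - 1) * M powr (p - 2)" by (simp add: c_def)
    ultimately show ?thesis by (elim DERIV_cong) (simp add: algebra_simps)
  qed
  have conv: "convex_on {0<..M} f"
    by (rule f''_ge0_imp_convex[OF _ d1 d2]) (use ge p in auto)
  define a b where "a = norm (x + h)" and "b = norm (x - h)"
  have ab: "a \<in> {0<..M}" "b \<in> {0<..M}" using False nz M by (auto simp: a_def b_def)
  have mid: "0 < norm x" "norm x \<le> (a + b) / 2" "(a + b) / 2 \<le> M"
    using False norm_midpoint_le[of x h] ab by (auto simp: a_def b_def)
  have "f (norm x) \<le> f ((a + b) / 2)"
  proof (rule DERIV_nonneg_imp_nondecreasing[OF mid(2)])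
    fix t assume xt: "norm x \<le> t" "t \<le> (a + b) / 2"
    then have t: "t \<in> {0<..M}" using less_le_trans[OF mid(1) xt(1)] mid(3) by simp
    have "(p - 1) * M powr (p - 2) \<le> 1 * t powr (p - 2)"
      using ge[OF t] p by (intro mult_mono) auto
    then have "0 \<le> p * t * (t powr (p - 2) - (p - 1) * M powr (p - 2))" using t p by simp
    also have "\<dots> = p * t powr (p - 1) - 2 * c * t"
    proof -
      have "t powr (p - 1) = t * t powr (p - 2)" using t by (simp add: powr_diff power2_eq_square)
      moreover have "2 * c * t = p * (p - 1) * M powr (p - 2) * t" by (simp add: c_def)
      ultimately show ?thesis by (simp add: algebra_simps)
    qed
    finally show "\<exists>y. (f has_real_derivative y) (at t) \<and> 0 \<le> y" using d1[OF t] by blast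
  qed
  also have "f ((a + b) / 2) \<le> (f a + f b) / 2"
    using convex_onD[OF conv, of "1 / 2" a b] ab by (simp add: field_simps)
  finally have "2 * norm x powr p + c * (a\<^sup>2 + b\<^sup>2 - 2 * (norm x)\<^sup>2) \<le> a powr p + b powr p"
    by (simp add: f_def algebra_simps)
  moreover have "a\<^sup>2 + b\<^sup>2 - 2 * (norm x)\<^sup>2 = 2 * (norm h)\<^sup>2"
    using parallelogram[of x h] by (simp add: a_def b_def)
  moreover have "c * (2 * (norm h)\<^sup>2) = p * (p - 1) * M powr (p - 2) * (norm h)\<^sup>2" by (simp add: c_def)
  ultimately show ?thesis by (simp flip: a_def b_def)
qed

text \<open>Where |y| <= |x| / (p - 1), \<open>burk_phi\<close> agrees with \<open>burk_Psi\<close>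
  at the base point and lies below it everywhere, so the inequality is inherited. Elsewhere it is
  locally the obstacle, and second-order estimates decide.\<close>

lemma zigzag_concave_burk_phi:
  assumes p: "1 < p" "p \<le> 2"
  shows "zigzag_concave (burk_phi p :: 'a::real_inner \<Rightarrow> 'a \<Rightarrow> real)"
proof (rule zigzag_concaveI_local[OF continuous_on_burk_phi[OF p]])
  fix x y h k :: 'a
  assume hk: "norm k \<le> norm h"
  define K where "K = 1 / (p - 1)"
  have K: "1 \<le> K" using p by (simp add: K_def)
  show "\<forall>\<^sub>F u in at_right (0::real). burk_phi p (x + u *\<^sub>R h) (y + u *\<^sub>R k)
      + burk_phi p (x - u *\<^sub>R h) (y - u *\<^sub>R k) \<le> 2 * burk_phi p x y"
  proof (cases "norm y \<le> K * norm x")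
    case True
    have "burk_phi p (x + u *\<^sub>R h) (y + u *\<^sub>R k) + burk_phi p (x - u *\<^sub>R h) (y - u *\<^sub>R k) \<le> 2 * burk_phi p x y" for u
    proof -
      have "norm (u *\<^sub>R k) \<le> norm (u *\<^sub>R h)" using hk by (simp add: mult_left_mono)
      then have "burk_Psi p K (x + u *\<^sub>R h) (y + u *\<^sub>R k) + burk_Psi p K (x - u *\<^sub>R h) (y - u *\<^sub>R k) \<le> 2 * burk_Psi p K x y"
        using zigzag_concave_burk_Psi[OF p, of K, where 'a='a] unfolding zigzag_concave_def by blast
      then show ?thesis
        using burk_phi_le_burk_Psi[OF p, of "x + u *\<^sub>R h" "y + u *\<^sub>R k"]
          burk_phi_le_burk_Psi[OF p, of "x - u *\<^sub>R h" "y - u *\<^sub>R k"]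
          burk_phi_eq_burk_Psi[OF p, of y x] True by (simp add: K_def)
    qed
    then show ?thesis by simp
  next
    case False
    \<comment> \<open>Here \<open>|y| powr p\<close> is tested against its tangent in \<open>|y|\<^sup>2\<close>, and the loss is compensated by the
      convexity of \<open>|x| powr p\<close> on the ball of radius \<open>|y|\<close>, which contains \<open>x\<close> in its interior.\<close>
    define s where "s = norm y"
    have "1 * norm x \<le> K * norm x" using K by (intro mult_right_mono) auto
    then have less: "K * norm x < s" "norm x < s" "0 < s"
      using False norm_ge_zero[of x] unfolding s_def by linarith+
    have pos: "0 < norm y - K * norm x" using less by (simp add: s_def)
    have "\<forall>\<^sub>F u in at_right (0::real). 0 < norm (y + u *\<^sub>R k) - K * norm (x + u *\<^sub>R h)"
      by (rule order_tendstoD(1)[OF _ pos]) (auto intro!: tendsto_eq_intros)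
    moreover have "\<forall>\<^sub>F u in at_right (0::real). 0 < norm (y - u *\<^sub>R k) - K * norm (x - u *\<^sub>R h)"
      by (rule order_tendstoD(1)[OF _ pos]) (auto intro!: tendsto_eq_intros)
    moreover have "\<forall>\<^sub>F u in at_right (0::real). norm (x + u *\<^sub>R h) < s"
      by (rule order_tendstoD(2)[OF _ less(2)]) (auto intro!: tendsto_eq_intros)
    moreover have "\<forall>\<^sub>F u in at_right (0::real). norm (x - u *\<^sub>R h) < s"
      by (rule order_tendstoD(2)[OF _ less(2)]) (auto intro!: tendsto_eq_intros)
    moreover have "\<forall>\<^sub>F u in at_right (0::real). x \<noteq> 0 \<longrightarrow> 0 < norm (x + u *\<^sub>R h)"
    proof (cases "x = 0")
      case False
      have "\<forall>\<^sub>F u in at_right (0::real). 0 < norm (x + u *\<^sub>R h)"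
        by (rule order_tendstoD(1)[where y = "norm x"]) (use False in \<open>auto intro!: tendsto_eq_intros\<close>)
      then show ?thesis by eventually_elim simp
    qed simp
    moreover have "\<forall>\<^sub>F u in at_right (0::real). x \<noteq> 0 \<longrightarrow> 0 < norm (x - u *\<^sub>R h)"
    proof (cases "x = 0")
      case False
      have "\<forall>\<^sub>F u in at_right (0::real). 0 < norm (x - u *\<^sub>R h)"
        by (rule order_tendstoD(1)[where y = "norm x"]) (use False in \<open>auto intro!: tendsto_eq_intros\<close>)
      then show ?thesis by eventually_elim simp
    qed simp
    ultimately show ?thesis
    proof eventually_elim
      case (elim u)
      define h' k' where "h' = u *\<^sub>R h" and "k' = u *\<^sub>R k"
      have "norm k' \<le> norm h'" using hk by (simp add: h'_def k'_def mult_left_mono)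
      then have kh: "(norm k')\<^sup>2 \<le> (norm h')\<^sup>2" by (intro power_mono) auto
      define c where "c = s powr (p - 2)"
      have c: "0 \<le> c" by (simp add: c_def)
      have "norm (y + k') powr p \<le> s powr p + p / 2 * c * ((norm (y + k'))\<^sup>2 - s\<^sup>2)"
        "norm (y - k') powr p \<le> s powr p + p / 2 * c * ((norm (y - k'))\<^sup>2 - s\<^sup>2)"
        unfolding c_def using p less by (intro powr_le_tangent_in_square; simp)+
      then have "norm (y + k') powr p + norm (y - k') powr p
          \<le> 2 * s powr p + p / 2 * c * ((norm (y + k'))\<^sup>2 + (norm (y - k'))\<^sup>2 - 2 * s\<^sup>2)"
        by (simp add: algebra_simps)
      also have "(norm (y + k'))\<^sup>2 + (norm (y - k'))\<^sup>2 - 2 * s\<^sup>2 = 2 * (norm k')\<^sup>2"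
        using parallelogram[of y k'] by (simp add: s_def)
      finally have Y: "norm (y + k') powr p + norm (y - k') powr p \<le> 2 * s powr p + p * c * (norm k')\<^sup>2"
        by simp
      have "2 * norm x powr p + p * (p - 1) * c * (norm h')\<^sup>2 \<le> norm (x + h') powr p + norm (x - h') powr p"
        unfolding c_def h'_def by (rule norm_powr_midpoint_gap[OF p]) (use elim less in auto)
      then have X: "K powr p * (2 * norm x powr p + p * (p - 1) * c * (norm h')\<^sup>2) \<le> K powr p * (norm (x + h') powr p + norm (x - h') powr p)"
        by (rule mult_left_mono) simp
      \<comment> \<open>From K >= 1 one gets \<open>K powr p * (p - 1)\<close> >=
        \<open>K * (p - 1)\<close> = 1. Hence the gain from |x|^p, despite its factor p - 1,
        outweighs the loss from |y|^p.\<close>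
      have "K powr 1 \<le> K powr p" using K p by (intro powr_mono) auto
      then have "K * (p - 1) \<le> K powr p * (p - 1)" using K p by simp
      then have "1 \<le> K powr p * (p - 1)" using p by (simp add: K_def)
      then have "1 * (p * c * (norm h')\<^sup>2) \<le> K powr p * (p - 1) * (p * c * (norm h')\<^sup>2)"
        using c p by (intro mult_right_mono) auto
      moreover have "p * c * (norm k')\<^sup>2 \<le> p * c * (norm h')\<^sup>2"
        using kh c p by (intro mult_left_mono) auto
      moreover have "burk_phi p (x + h') (y + k') = norm (y + k') powr p - K powr p * norm (x + h') powr p"
        "burk_phi p (x - h') (y - k') = norm (y - k') powr p - K powr p * norm (x - h') powr p"
        "burk_phi p x y = s powr p - K powr p * norm x powr p"
        using elim less by (auto simp: burk_phi_def K_def h'_def k'_def s_def)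
      ultimately show ?case
        using X Y unfolding h'_def[symmetric] k'_def[symmetric] by (simp add: algebra_simps)
    qed
  qed
qed

section \<open>Upper bounds for the Bellman function\<close>

lemma Hoelder_two:
  fixes a1 a2 b1 b2 p q :: real
  assumes p: "1 < p" "1 < q" "1 / p + 1 / q = 1"
    and nn: "0 \<le> a1" "0 \<le> a2" "0 \<le> b1" "0 \<le> b2"
  shows "a1 powr (1 / p) * b1 powr (1 / q) + a2 powr (1 / p) * b2 powr (1 / q)
    \<le> (a1 + a2) powr (1 / p) * (b1 + b2) powr (1 / q)"
proof (cases "a1 + a2 = 0 \<or> b1 + b2 = 0")
  case True
  then show ?thesis using nn by (auto simp: add_nonneg_eq_0_iff)
next
  case False
  define A B where "A = a1 + a2" and "B = b1 + b2"
  have AB: "0 < A" "0 < B" using False nn by (auto simp: A_def B_def less_le)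
  have young: "a powr (1 / p) * b powr (1 / q) \<le> A powr (1 / p) * B powr (1 / q) * (1 / p * (a / A) + 1 / q * (b / B))"
    if "0 \<le> a" "0 \<le> b" for a b
  proof -
    have "(a / A) powr (1 / p) * (b / B) powr (1 / q) \<le> 1 / p * (a / A) + 1 / q * (b / B)"
    proof (cases "a = 0 \<or> b = 0")
      case True
      then show ?thesis using that AB p by auto
    next
      case False
      then show ?thesis using that AB p by (intro Youngs_inequality_0) auto
    qed
    then have "A powr (1 / p) * B powr (1 / q) * ((a / A) powr (1 / p) * (b / B) powr (1 / q))
      \<le> A powr (1 / p) * B powr (1 / q) * (1 / p * (a / A) + 1 / q * (b / B))"
      by (intro mult_left_mono) auto
    then show ?thesis using AB that by (simp add: powr_divide)
  qed
  have "a1 powr (1 / p) * b1 powr (1 / q) + a2 powr (1 / p) * b2 powr (1 / q)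
    \<le> A powr (1 / p) * B powr (1 / q) * (1 / p * (a1 / A) + 1 / q * (b1 / B))
      + A powr (1 / p) * B powr (1 / q) * (1 / p * (a2 / A) + 1 / q * (b2 / B))"
    by (intro add_mono young nn)
  also have "\<dots> = A powr (1 / p) * B powr (1 / q) * (1 / p * ((a1 + a2) / A) + 1 / q * ((b1 + b2) / B))"
    by (simp add: distrib_left add_divide_distrib)
  also have "\<dots> = A powr (1 / p) * B powr (1 / q)"
    using AB p by (simp flip: A_def B_def)
  finally show ?thesis by (simp add: A_def B_def)
qed

section \<open>Conjugate exponents, the domain, and the solved system\<close>

lemma conj_exponent_facts:
  assumes "1 < p"
  shows "1 < conj_exponent p" and "1 / p + 1 / conj_exponent p = 1"
    and "conj_exponent (conj_exponent p) = p" and "p / conj_exponent p = p - 1"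
  using assms by (auto simp: conj_exponent_def field_simps)

lemma bellman_domD:
  assumes "(\<zeta>, \<eta>, Z, H) \<in> bellman_dom p"
  shows "0 \<le> Z" "0 \<le> H" "norm \<zeta> powr p \<le> Z" "norm \<eta> powr conj_exponent p \<le> H"
  using assms by (auto simp: bellman_dom_def)

lemma burk_system_iff:
  assumes p: "1 < p" and "0 < g" "g < 1 / (p - 1)"
  shows "(1 - (p - 1) * Y) * (1 + Y) powr (p - 1) / ((1 - (p - 1) * g) * (1 + g) powr (p - 1)) = \<rho>
      \<longleftrightarrow> burk_F p Y = \<rho> * burk_F p g"
    and "Y * (1 + Y) powr (p - 2) / (g * (1 + g) powr (p - 2)) = \<theta> \<longleftrightarrow> burk_M p Y = \<theta> * burk_M p g"
proof -
  have "0 < 1 - (p - 1) * g" using assms by (simp add: field_simps)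
  then have "burk_F p g > 0" using assms by (simp add: burk_F_def)
  then show "(1 - (p - 1) * Y) * (1 + Y) powr (p - 1) / ((1 - (p - 1) * g) * (1 + g) powr (p - 1)) = \<rho>
      \<longleftrightarrow> burk_F p Y = \<rho> * burk_F p g"
    unfolding burk_F_def[symmetric] by (auto simp: divide_eq_eq)
  have "burk_M p g > 0" using assms by (simp add: burk_M_pos)
  then show "Y * (1 + Y) powr (p - 2) / (g * (1 + g) powr (p - 2)) = \<theta> \<longleftrightarrow> burk_M p Y = \<theta> * burk_M p g"
    unfolding burk_M_def[symmetric] by (auto simp: divide_eq_eq)
qed

text \<open>Existence and uniqueness resolve the definite description. The identity for
  \<open>\<theta> / \<rho>\<close> says that the slope of \<gamma> as a function of Y is the ratio
  of the two coefficients in \<open>cal_B\<close>, so moving along the tangent leaves the expression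
  for \<open>cal_B\<close> unchanged.\<close>

lemma cal_B_system:
  fixes \<zeta> \<eta> :: "'a::real_inner"
  assumes p: "1 < p" "p \<le> 2" and dom: "(\<zeta>, \<eta>, Z, H) \<in> bellman_dom p"
    and lt: "norm \<eta> powr conj_exponent p * Z < norm \<zeta> powr p * H" and Z: "norm \<zeta> powr p < Z"
  defines "q \<equiv> conj_exponent p"
  defines "\<rho> \<equiv> Z / norm \<zeta> powr p"
  obtains g Y \<theta> where "0 \<le> Y" "Y < g" "g < 1 / (p - 1)" "0 \<le> \<theta>" "\<theta> < 1"
    "burk_F p Y = \<rho> * burk_F p g" "burk_M p Y = \<theta> * burk_M p g"
    "\<theta> / \<rho> * (Z powr (1 / p) * H powr (1 / q)) = norm \<zeta> * norm \<eta>"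
    "norm \<eta> = 0 \<Longrightarrow> \<theta> = 0"
    "cal_B p (\<zeta>, \<eta>, Z, H) = g * Z powr (1 / p) * H powr (1 / q) - norm \<zeta> * norm \<eta> * Y"
proof -
  define r n where "r = norm \<zeta>" and "n = norm \<eta>"
  note q = conj_exponent_facts[OF p(1), folded q_def]
  have ZH: "0 \<le> Z" "0 \<le> H" "r powr p \<le> Z" "n powr q \<le> H"
    using bellman_domD[OF dom] by (auto simp: r_def n_def q_def)
  have rn: "0 \<le> r" "0 \<le> n" by (auto simp: r_def n_def)
  have lt': "n powr q * Z < r powr p * H" using lt by (simp add: r_def n_def q_def)
  moreover have "0 \<le> n powr q * Z" using ZH by simp
  ultimately have "0 < r powr p * H" by linarith
  then have rH: "0 < r" "0 < H" using rn ZH by (auto simp: zero_less_mult_iff)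
  have Zpos: "0 < Z" using powr_ge_zero Z by (rule le_less_trans)
  define t where "t = (n powr q * Z) / (r powr p * H)"
  define \<theta> where "\<theta> = t powr (1 / q)"
  have t: "0 \<le> t" "t < 1" using lt' rH ZH by (auto simp: t_def)
  have \<theta>: "0 \<le> \<theta>" "\<theta> < 1"
    using powr_less_mono2[of "1 / q" t 1] t q by (auto simp: \<theta>_def)
  have \<rho>: "1 < \<rho>" using Z rH by (simp add: \<rho>_def r_def)
  obtain g Y where gY: "0 \<le> Y" "Y < g" "g < 1 / (p - 1)"
    "burk_F p Y = \<rho> * burk_F p g" "burk_M p Y = \<theta> * burk_M p g"
    using burk_system_exists[OF p \<rho> \<theta>] by metis
  have sys: "bellman_system p (\<zeta>, \<eta>, Z, H) g' Y' \<longleftrightarrow> 0 \<le> Y' \<and> Y' < g' \<and> g' < 1 / (p - 1) \<and>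
      burk_F p Y' = \<rho> * burk_F p g' \<and> burk_M p Y' = \<theta> * burk_M p g'" for g' Y'
  proof (cases "0 \<le> Y' \<and> Y' < g' \<and> g' < 1 / (p - 1)")
    case True
    then have g': "0 < g'" "g' < 1 / (p - 1)" by auto
    show ?thesis
      unfolding bellman_system_def split_conv burk_system_iff[OF p(1) g'] 
      by (simp add: \<rho>_def \<theta>_def t_def r_def n_def q_def)
  next
    case False
    then show ?thesis by (auto simp: bellman_system_def)
  qed
  have "(THE (g, Y). bellman_system p (\<zeta>, \<eta>, Z, H) g Y) = (g, Y)"
  proof (rule the_equality)
    show "case (g, Y) of (g, Y) \<Rightarrow> bellman_system p (\<zeta>, \<eta>, Z, H) g Y"
      using gY sys by simp
    fix z assume "case z of (g, Y) \<Rightarrow> bellman_system p (\<zeta>, \<eta>, Z, H) g Y"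
    then show "z = (g, Y)"
      using burk_system_unique[OF p \<rho> \<theta> _ _ _ _ gY(1,2,4,5)] unfolding sys by (cases z) auto
  qed
  then have B: "cal_B p (\<zeta>, \<eta>, Z, H) = g * Z powr (1 / p) * H powr (1 / q) - norm \<zeta> * norm \<eta> * Y"
    using lt Z by (simp add: cal_B_def q_def Let_def)
  have "\<theta> = n * Z powr (1 / q) / (r powr (p - 1) * H powr (1 / q))"
    unfolding \<theta>_def t_def using rn ZH rH q by (simp add: powr_divide powr_mult powr_powr)
  then have "\<theta> * (r powr (p - 1) * H powr (1 / q)) = n * Z powr (1 / q)"
    using rH by simp
  moreover have "Z powr (1 / q) * Z powr (1 / p) = Z"
    using q Zpos by (simp add: add.commute flip: powr_add)
  moreover have "\<theta> / \<rho> * (Z powr (1 / p) * H powr (1 / q))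
      = r / Z * (\<theta> * (r powr (p - 1) * H powr (1 / q))) * Z powr (1 / p)"
    using rH Zpos by (simp add: \<rho>_def r_def[symmetric] powr_diff)
  ultimately have eq: "\<theta> / \<rho> * (Z powr (1 / p) * H powr (1 / q)) = r * n"
    using Zpos by (simp add: mult.assoc)
  show thesis
    by (rule that[OF gY(1-3) \<theta> gY(4,5) _ _ B])
       (use eq q in \<open>auto simp: r_def n_def \<theta>_def t_def\<close>)
qed

text \<open>Hoelder's inequality is applied to the pairs (A, s^p) and (H - n^q, n^q), where A is the
  best constant times Z - r^p. This serves the points of the domain where no system is
  involved.\<close>

lemma Hoelder_boundary:
  fixes r n s Z H S C :: real
  assumes p: "1 < p" "p \<le> 2" and q: "q = conj_exponent p"
    and rn: "0 \<le> n" "0 \<le> s" and ZH: "r powr p \<le> Z" "n powr q \<le> H"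
    and C: "(1 / (p - 1)) powr p \<le> C" and S: "C * (Z - r powr p) + s powr p \<le> S"
  shows "(H - n powr q) powr (1 / q) * (Z - r powr p) powr (1 / p) / (p - 1) + s * n \<le> S powr (1 / p) * H powr (1 / q)"
proof -
  note qf = conj_exponent_facts[OF p(1), folded q]
  define A where "A = (1 / (p - 1)) powr p * (Z - r powr p)"
  have A: "0 \<le> A" using ZH by (simp add: A_def)
  have "A powr (1 / p) = (Z - r powr p) powr (1 / p) / (p - 1)"
    using p ZH by (simp add: A_def powr_mult powr_powr)
  moreover have "(s powr p) powr (1 / p) = s" "(n powr q) powr (1 / q) = n"
    using p qf rn by (simp_all add: powr_powr)
  ultimately have "(H - n powr q) powr (1 / q) * (Z - r powr p) powr (1 / p) / (p - 1) + s * n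
     = A powr (1 / p) * (H - n powr q) powr (1 / q) + (s powr p) powr (1 / p) * (n powr q) powr (1 / q)"
    by simp
  also have "\<dots> \<le> (A + s powr p) powr (1 / p) * (H - n powr q + n powr q) powr (1 / q)"
    by (rule Hoelder_two) (use p qf A ZH in auto)
  also have "\<dots> \<le> S powr (1 / p) * H powr (1 / q)"
  proof -
    have "A \<le> C * (Z - r powr p)" unfolding A_def using C ZH by (intro mult_right_mono) auto
    then have "A + s powr p \<le> S" using S by linarith
    then have "(A + s powr p) powr (1 / p) \<le> S powr (1 / p)"
      using A p by (intro powr_mono2) auto
    then show ?thesis by (simp add: mult_right_mono)
  qed
  finally show ?thesis .
qed

text \<open>When Z = |\<zeta>|^p the right-hand side vanishes together with \<open>cal_B\<close> in
  either case, so one formula covers everything outside the system.\<close>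

lemma cal_B_boundary_le:
  fixes \<zeta> \<eta> :: "'a::real_inner"
  assumes "1 < p" "p \<le> 2" and dom: "(\<zeta>, \<eta>, Z, H) \<in> bellman_dom p"
    and "norm \<zeta> powr p * H \<le> norm \<eta> powr conj_exponent p * Z \<or> \<not> norm \<zeta> powr p < Z"
  shows "cal_B p (\<zeta>, \<eta>, Z, H) \<le>
    (H - norm \<eta> powr conj_exponent p) powr (1 / conj_exponent p) * (Z - norm \<zeta> powr p) powr (1 / p) / (p - 1)"
  using assms by (auto simp: cal_B_def Let_def)

text \<open>In the system case let \<open>l\<close> be the height of the tangent line at X = |y| /
  |\<zeta>|. The slope identity turns the left-hand side into
  \<open>Z powr (1 / p) * l * H powr (1 / q)\<close>, and the majorization at \<open>l\<close>
  followed by the tangent inequality bounds \<open>Z * l powr p\<close>.\<close>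

lemma cal_B_le_burk_Psi:
  fixes \<zeta> \<eta> y :: "'a::real_inner"
  assumes p: "1 < p" "p \<le> 2" and dom: "(\<zeta>, \<eta>, Z, H) \<in> bellman_dom p" and c: "0 < c"
  shows "cal_B p (\<zeta>, \<eta>, Z, H) + norm y * norm \<eta>
    \<le> (burk_C p c * Z + burk_Psi p c \<zeta> y) powr (1 / p) * H powr (1 / conj_exponent p)"
proof -
  define q where "q = conj_exponent p"
  note qf = conj_exponent_facts[OF p(1), folded q_def]
  define S where "S = burk_C p c * Z + burk_Psi p c \<zeta> y"
  note ZH = bellman_domD[OF dom, folded q_def]
  have S: "burk_C p c * (Z - norm \<zeta> powr p) + norm y powr p \<le> S"
    using burk_Psi_ge[OF p c, of y \<zeta>] by (simp add: S_def algebra_simps)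
  have "cal_B p (\<zeta>, \<eta>, Z, H) + norm y * norm \<eta> \<le> S powr (1 / p) * H powr (1 / q)"
  proof (cases "norm \<zeta> powr p * H \<le> norm \<eta> powr q * Z \<or> \<not> norm \<zeta> powr p < Z")
    case True
    then show ?thesis
      using cal_B_boundary_le[OF p dom, folded q_def]
        Hoelder_boundary[OF p q_def _ _ ZH(3,4) burk_C_ge[OF p c] S] by fastforce
  next
    case False
    define \<rho> where "\<rho> = Z / norm \<zeta> powr p"
    obtain g Y \<theta> where gY: "0 \<le> Y" "Y < g" "g < 1 / (p - 1)" "0 \<le> \<theta>" "\<theta> < 1"
      "burk_F p Y = \<rho> * burk_F p g" "burk_M p Y = \<theta> * burk_M p g"
      "\<theta> / \<rho> * (Z powr (1 / p) * H powr (1 / q)) = norm \<zeta> * norm \<eta>"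
      "cal_B p (\<zeta>, \<eta>, Z, H) = g * Z powr (1 / p) * H powr (1 / q) - norm \<zeta> * norm \<eta> * Y"
      using cal_B_system[OF p dom] False unfolding q_def[symmetric] \<rho>_def[symmetric] by (metis not_le)
    have "norm \<zeta> powr p * H > 0" using False ZH by (smt (verit) mult_nonneg_nonneg powr_ge_zero)
    then have \<zeta>: "0 < norm \<zeta>" by (cases "\<zeta> = 0") (use p in auto)
    have Zpos: "0 < Z" using False \<zeta> by (smt (verit) powr_gt_zero)
    have \<rho>: "1 < \<rho>" using False \<zeta> by (simp add: \<rho>_def)
    define X where "X = norm y / norm \<zeta>"
    define l where "l = g + \<theta> / \<rho> * (X - Y)"
    have X: "0 \<le> X" by (simp add: X_def)
    have l: "0 < l" "burk_F p X \<le> \<rho> * burk_F p l"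
      using burk_F_tangent[OF p gY(1,2) \<rho> gY(4-7) X] by (auto simp: l_def)
    have \<kappa>: "0 \<le> burk_kappa p c / (p - 1)" using p by (simp add: burk_kappa_def)
    have "l powr p \<le> burk_C p c - burk_kappa p c / (p - 1) * burk_F p l"
      using burk_majorization(1)[OF p c] l by simp
    also have "\<dots> \<le> burk_C p c - burk_kappa p c / (p - 1) * (burk_F p X / \<rho>)"
    proof -
      have "burk_F p X / \<rho> \<le> burk_F p l" using l \<rho> by (simp add: field_simps)
      then show ?thesis using mult_left_mono[OF _ \<kappa>] by (meson diff_left_mono)
    qed
    finally have "Z * l powr p \<le> Z * (burk_C p c - burk_kappa p c / (p - 1) * (burk_F p X / \<rho>))"
      using ZH by (intro mult_left_mono) auto
    also have "\<dots> = S"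
    proof -
      have "Z * (burk_F p X / \<rho>) = burk_W p (norm \<zeta>) (norm y)"
        unfolding X_def using burk_W_eq_burk_F[OF \<zeta>, of "norm y" p] \<zeta> Zpos by (simp add: \<rho>_def)
      moreover have "Z * (a - b * f) = a * Z + - (b * (Z * f))" for a b f :: real
        by (simp add: algebra_simps)
      ultimately show ?thesis unfolding S_def burk_Psi_def by (simp only:)
    qed
    finally have "(Z * l powr p) powr (1 / p) \<le> S powr (1 / p)"
      using ZH p by (intro powr_mono2) auto
    moreover have "(Z * l powr p) powr (1 / p) = Z powr (1 / p) * l"
      using ZH l p by (simp add: powr_mult powr_powr)
    ultimately have "Z powr (1 / p) * l * H powr (1 / q) \<le> S powr (1 / p) * H powr (1 / q)"
      by (intro mult_right_mono) auto
    moreover have "Z powr (1 / p) * l * H powr (1 / q) = cal_B p (\<zeta>, \<eta>, Z, H) + norm y * norm \<eta>"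
    proof -
      have "norm \<zeta> * norm \<eta> * X = norm y * norm \<eta>" using \<zeta> by (simp add: X_def)
      have "Z powr (1 / p) * l * H powr (1 / q)
          = g * Z powr (1 / p) * H powr (1 / q) + \<theta> / \<rho> * (Z powr (1 / p) * H powr (1 / q)) * (X - Y)"
        by (simp add: l_def distrib_left distrib_right mult_ac)
      also have "\<dots> = g * Z powr (1 / p) * H powr (1 / q) + norm \<zeta> * norm \<eta> * (X - Y)"
        by (simp only: gY)
      finally show ?thesis
        using gY(9) \<open>norm \<zeta> * norm \<eta> * X = _\<close> by (simp add: right_diff_distrib)
    qed
    ultimately show ?thesis by simp
  qed
  then show ?thesis by (simp add: S_def q_def)
qed

text \<open>For small |y| this is the bound for \<open>burk_Psi\<close> at g = 1 / (p - 1). For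
  large |y| the tangent line is estimated beyond K = 1 / (p - 1) by a convex combination of K and X,
  and convexity of \<open>t powr p\<close> yields the obstacle.\<close>

lemma cal_B_le_burk_phi:
  fixes \<zeta> \<eta> y :: "'a::real_inner"
  assumes p: "1 < p" "p \<le> 2" and dom: "(\<zeta>, \<eta>, Z, H) \<in> bellman_dom p"
  shows "cal_B p (\<zeta>, \<eta>, Z, H) + norm y * norm \<eta>
    \<le> ((1 / (p - 1)) powr p * Z + burk_phi p \<zeta> y) powr (1 / p) * H powr (1 / conj_exponent p)"
proof (cases "norm y \<le> norm \<zeta> / (p - 1)")
  case True
  then show ?thesis
    using cal_B_le_burk_Psi[OF p dom, of "1 / (p - 1)" y] burk_phi_eq_burk_Psi[OF p True] burk_C_inverse[OF p] p
    by simp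
next
  case big: False
  define q where "q = conj_exponent p"
  note qf = conj_exponent_facts[OF p(1), folded q_def]
  define K where "K = 1 / (p - 1)"
  have K: "0 < K" using p by (simp add: K_def)
  define S where "S = K powr p * (Z - norm \<zeta> powr p) + norm y powr p"
  have S: "S = K powr p * Z + burk_phi p \<zeta> y"
    using big by (simp add: S_def burk_phi_def K_def algebra_simps)
  note ZH = bellman_domD[OF dom, folded q_def]
  have "cal_B p (\<zeta>, \<eta>, Z, H) + norm y * norm \<eta> \<le> S powr (1 / p) * H powr (1 / q)"
  proof (cases "norm \<zeta> powr p * H \<le> norm \<eta> powr q * Z \<or> \<not> norm \<zeta> powr p < Z")
    case True
    have "(H - norm \<eta> powr q) powr (1 / q) * (Z - norm \<zeta> powr p) powr (1 / p) / (p - 1) + norm y * norm \<eta>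
        \<le> S powr (1 / p) * H powr (1 / q)"
      by (rule Hoelder_boundary[OF p q_def _ _ ZH(3,4)]) (auto simp: S_def K_def)
    then show ?thesis
      using cal_B_boundary_le[OF p dom, folded q_def] True by linarith
  next
    case False
    define \<rho> where "\<rho> = Z / norm \<zeta> powr p"
    obtain g Y \<theta> where gY: "0 \<le> Y" "Y < g" "g < 1 / (p - 1)" "0 \<le> \<theta>" "\<theta> < 1"
      "burk_F p Y = \<rho> * burk_F p g" "burk_M p Y = \<theta> * burk_M p g"
      "\<theta> / \<rho> * (Z powr (1 / p) * H powr (1 / q)) = norm \<zeta> * norm \<eta>"
      "cal_B p (\<zeta>, \<eta>, Z, H) = g * Z powr (1 / p) * H powr (1 / q) - norm \<zeta> * norm \<eta> * Y"
      using cal_B_system[OF p dom] False unfolding q_def[symmetric] \<rho>_def[symmetric] by (metis not_le)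
    have "norm \<zeta> powr p * H > 0" using False ZH by (smt (verit) mult_nonneg_nonneg powr_ge_zero)
    then have \<zeta>: "0 < norm \<zeta>" by (cases "\<zeta> = 0") (use p in auto)
    have Zpos: "0 < Z" using False \<zeta> by (smt (verit) powr_gt_zero)
    have \<rho>: "1 < \<rho>" using False \<zeta> by (simp add: \<rho>_def)
    define X where "X = norm y / norm \<zeta>"
    have X: "K < X" using big \<zeta> by (simp add: X_def K_def field_simps)
    define l where "l = g + \<theta> / \<rho> * (X - Y)"
    \<comment> \<open>Since \<open>burk_F p\<close> vanishes at K and is negative beyond it, the
      tangent inequality at K forces the line to be at most K there.\<close>
    have "0 < g + \<theta> / \<rho> * (K - Y)" "burk_F p K \<le> \<rho> * burk_F p (g + \<theta> / \<rho> * (K - Y))"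
      using burk_F_tangent[OF p gY(1,2) \<rho> gY(4-7), of K] K by auto
    then have "g + \<theta> / \<rho> * (K - Y) \<le> K"
      using burk_F_le_iff[of p "g + \<theta> / \<rho> * (K - Y)" K] p K \<rho> by (simp add: K_def zero_le_mult_iff)
    moreover have "\<theta> / \<rho> * (X - K) \<le> 1 / \<rho> * (X - K)"
      using gY \<rho> X by (intro mult_right_mono divide_right_mono) auto
    ultimately have lK: "l \<le> K + 1 / \<rho> * (X - K)"
      by (simp add: l_def right_diff_distrib)
    have lpos: "0 < l"
      using burk_F_tangent(1)[OF p gY(1,2) \<rho> gY(4-7), of X] X K by (simp add: l_def)
    have "l powr p \<le> ((1 - 1 / \<rho>) * K + 1 / \<rho> * X) powr p"
      using lK lpos p by (intro powr_mono2) (auto simp: algebra_simps diff_divide_distrib)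
    also have "\<dots> \<le> (1 - 1 / \<rho>) * K powr p + 1 / \<rho> * X powr p"
      using convex_onD[OF powr_convex[of p], of "1 / \<rho>" K X] K X p \<rho> by simp
    finally have "Z * l powr p \<le> Z * ((1 - 1 / \<rho>) * K powr p + 1 / \<rho> * X powr p)"
      using ZH by (intro mult_left_mono) auto
    also have "\<dots> = S"
      using Zpos \<zeta> by (simp add: S_def \<rho>_def X_def powr_divide field_simps)
    finally have "(Z * l powr p) powr (1 / p) \<le> S powr (1 / p)"
      using ZH p by (intro powr_mono2) auto
    moreover have "(Z * l powr p) powr (1 / p) = Z powr (1 / p) * l"
      using ZH lpos p by (simp add: powr_mult powr_powr)
    ultimately have "Z powr (1 / p) * l * H powr (1 / q) \<le> S powr (1 / p) * H powr (1 / q)"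
      by (intro mult_right_mono) auto
    moreover have "Z powr (1 / p) * l * H powr (1 / q) = cal_B p (\<zeta>, \<eta>, Z, H) + norm y * norm \<eta>"
    proof -
      have "norm \<zeta> * norm \<eta> * X = norm y * norm \<eta>" using \<zeta> by (simp add: X_def)
      have "Z powr (1 / p) * l * H powr (1 / q)
          = g * Z powr (1 / p) * H powr (1 / q) + \<theta> / \<rho> * (Z powr (1 / p) * H powr (1 / q)) * (X - Y)"
        by (simp add: l_def distrib_left distrib_right mult_ac)
      also have "\<dots> = g * Z powr (1 / p) * H powr (1 / q) + norm \<zeta> * norm \<eta> * (X - Y)"
        by (simp only: gY)
      finally show ?thesis
        using gY(9) \<open>norm \<zeta> * norm \<eta> * X = _\<close> by (simp add: right_diff_distrib)
    qed
    ultimately show ?thesis by simp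
  qed
  then show ?thesis by (simp add: S K_def q_def)
qed

section \<open>The Bellman function as an infimum\<close>

definition bellman_majorant :: "real \<Rightarrow> real \<Rightarrow> ('a::real_inner \<Rightarrow> 'a \<Rightarrow> real) \<Rightarrow> bool" where
  "bellman_majorant p C \<phi> \<longleftrightarrow> 0 \<le> C \<and> zigzag_concave \<phi> \<and>
     (\<forall>x y. norm y powr p - C * norm x powr p \<le> \<phi> x y) \<and>
     (\<forall>\<zeta> \<eta> Z H y. (\<zeta>, \<eta>, Z, H) \<in> bellman_dom p \<longrightarrow>
        cal_B p (\<zeta>, \<eta>, Z, H) + norm y * norm \<eta>
          \<le> (C * Z + \<phi> \<zeta> y) powr (1 / p) * H powr (1 / conj_exponent p))"

lemma bellman_majorant_burk_Psi:
  assumes p: "1 < p" "p \<le> 2" and c: "0 < c"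
  shows "bellman_majorant p (burk_C p c) (burk_Psi p c :: 'a::real_inner \<Rightarrow> 'a \<Rightarrow> real)"
proof -
  have "0 \<le> burk_C p c" using burk_C_ge[OF p c] powr_ge_zero by (rule order_trans[rotated])
  then show ?thesis
    unfolding bellman_majorant_def
    using zigzag_concave_burk_Psi[OF p] burk_Psi_ge[OF p c] cal_B_le_burk_Psi[OF p _ c] by blast
qed

lemma bellman_majorant_burk_phi:
  assumes p: "1 < p" "p \<le> 2"
  shows "bellman_majorant p ((1 / (p - 1)) powr p) (burk_phi p :: 'a::real_inner \<Rightarrow> 'a \<Rightarrow> real)"
  unfolding bellman_majorant_def
proof (intro conjI allI impI)
  show "0 \<le> (1 / (p - 1)) powr p" by simp
  show "zigzag_concave (burk_phi p :: 'a \<Rightarrow> 'a \<Rightarrow> real)" by (rule zigzag_concave_burk_phi[OF p])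
qed (use burk_phi_ge[OF p] cal_B_le_burk_phi[OF p] in auto)

lemma collinear_with_norm:
  fixes e :: "'a::real_inner"
  assumes "0 \<le> c" "e = 0 \<Longrightarrow> c = 0"
  obtains y where "norm y = c" "y \<bullet> e = c * norm e"
proof
  show "norm ((c / norm e) *\<^sub>R e) = c" using assms by auto
  show "(c / norm e) *\<^sub>R e \<bullet> e = c * norm e" by (simp add: dot_square_norm power2_eq_square)
qed

lemma bellman_majorant_midpoint:
  fixes \<zeta>0 \<zeta>1 \<eta>0 \<eta>1 y :: "'a::real_inner"
  assumes p: "1 < p" and maj: "bellman_majorant p C \<phi>"
    and dom: "(\<zeta>0, \<eta>0, Z0, H0) \<in> bellman_dom p" "(\<zeta>1, \<eta>1, Z1, H1) \<in> bellman_dom p"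
  shows "(cal_B p (\<zeta>0, \<eta>0, Z0, H0) + cal_B p (\<zeta>1, \<eta>1, Z1, H1)) / 2
      + norm ((\<zeta>1 - \<zeta>0) /\<^sub>R 2) * norm ((\<eta>1 - \<eta>0) /\<^sub>R 2)
    \<le> (C * ((Z0 + Z1) /\<^sub>R 2) + \<phi> ((\<zeta>0 + \<zeta>1) /\<^sub>R 2) y) powr (1 / p) * ((H0 + H1) /\<^sub>R 2) powr (1 / conj_exponent p)
      - y \<bullet> ((\<eta>0 + \<eta>1) /\<^sub>R 2)"
proof -
  define q where "q = conj_exponent p"
  note qf = conj_exponent_facts[OF p, folded q_def]
  define \<zeta> \<eta> h e where "\<zeta> = (\<zeta>0 + \<zeta>1) /\<^sub>R 2" and "\<eta> = (\<eta>0 + \<eta>1) /\<^sub>R 2"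
    and "h = (\<zeta>1 - \<zeta>0) /\<^sub>R 2" and "e = (\<eta>1 - \<eta>0) /\<^sub>R 2"
  have half: "(a + b) /\<^sub>R 2 + (b - a) /\<^sub>R 2 = b" "(a + b) /\<^sub>R 2 - (b - a) /\<^sub>R 2 = a" for a b :: 'a
    by (simp_all flip: scaleR_right_distrib scaleR_right_diff_distrib)
  have pts: "\<zeta>1 = \<zeta> + h" "\<zeta>0 = \<zeta> - h" "\<eta>1 = \<eta> + e" "\<eta>0 = \<eta> - e"
    by (simp_all only: \<zeta>_def \<eta>_def h_def e_def half)
  \<comment> \<open>For e = 0 the division by 0 yields k = 0, and both properties of
    \<open>k\<close> persist.\<close>
  define k where "k = (norm h / norm e) *\<^sub>R e"
  have k: "norm k \<le> norm h" "k \<bullet> e = norm h * norm e"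
    by (auto simp: k_def dot_square_norm power2_eq_square)
  define S0 S1 S where "S0 = C * Z0 + \<phi> (\<zeta> - h) (y - k)" and "S1 = C * Z1 + \<phi> (\<zeta> + h) (y + k)"
    and "S = C * ((Z0 + Z1) /\<^sub>R 2) + \<phi> \<zeta> y"
  have nonneg: "0 \<le> C * Z + \<phi> x w" if "norm x powr p \<le> Z" for x w Z
  proof -
    have "C * norm x powr p \<le> C * Z"
      using maj that by (intro mult_left_mono) (auto simp: bellman_majorant_def)
    moreover have "norm w powr p - C * norm x powr p \<le> \<phi> x w"
      using maj by (auto simp: bellman_majorant_def)
    moreover have "0 \<le> norm w powr p" by simp
    ultimately show ?thesis by linarith
  qed
  have S01: "0 \<le> S0" "0 \<le> S1"
    unfolding S0_def S1_def using bellman_domD(3)[OF dom(1)] bellman_domD(3)[OF dom(2)]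
    by (auto intro!: nonneg simp: pts)
  \<comment> \<open>The product of norms is weakened to an inner product because the latter is
    bilinear: the two endpoint terms then add up to the midpoint term and the gain from k and
    e.\<close>
  have upper: "cal_B p (\<zeta>', \<eta>', Z', H') + w \<bullet> \<eta>' \<le> (C * Z' + \<phi> \<zeta>' w) powr (1 / p) * H' powr (1 / q)"
    if "(\<zeta>', \<eta>', Z', H') \<in> bellman_dom p" for \<zeta>' \<eta>' Z' H' w
  proof -
    have "cal_B p (\<zeta>', \<eta>', Z', H') + norm w * norm \<eta>' \<le> (C * Z' + \<phi> \<zeta>' w) powr (1 / p) * H' powr (1 / q)"
      using maj that by (simp add: bellman_majorant_def q_def)
    moreover have "w \<bullet> \<eta>' \<le> norm w * norm \<eta>'" by (rule norm_cauchy_schwarz)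
    ultimately show ?thesis by linarith
  qed
  have "cal_B p (\<zeta>0, \<eta>0, Z0, H0) + cal_B p (\<zeta>1, \<eta>1, Z1, H1) + ((y - k) \<bullet> \<eta>0 + (y + k) \<bullet> \<eta>1)
      \<le> S0 powr (1 / p) * H0 powr (1 / q) + S1 powr (1 / p) * H1 powr (1 / q)"
    using upper[OF dom(1), of "y - k"] upper[OF dom(2), of "y + k"] by (simp add: S0_def S1_def pts)
  also have "\<dots> \<le> (S0 + S1) powr (1 / p) * (H0 + H1) powr (1 / q)"
    using bellman_domD(2)[OF dom(1)] bellman_domD(2)[OF dom(2)] S01
    by (intro Hoelder_two p qf)
  also have "\<dots> \<le> (2 * S) powr (1 / p) * (2 * ((H0 + H1) /\<^sub>R 2)) powr (1 / q)"
  proof -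
    have "\<phi> (\<zeta> + h) (y + k) + \<phi> (\<zeta> - h) (y - k) \<le> 2 * \<phi> \<zeta> y"
      using maj k by (auto simp: bellman_majorant_def zigzag_concave_def)
    moreover have "2 * (C * ((Z0 + Z1) /\<^sub>R 2)) = C * Z0 + C * Z1" by (simp add: field_simps)
    ultimately have "S0 + S1 \<le> 2 * S" unfolding S0_def S1_def S_def distrib_left by linarith
    then have "(S0 + S1) powr (1 / p) \<le> (2 * S) powr (1 / p)"
      using S01 p by (intro powr_mono2) auto
    moreover have "2 * ((H0 + H1) /\<^sub>R 2) = H0 + H1" by (simp add: field_simps)
    ultimately show ?thesis by (metis mult_right_mono powr_ge_zero)
  qed
  also have "\<dots> = (2 powr (1 / p) * 2 powr (1 / q)) * (S powr (1 / p) * ((H0 + H1) /\<^sub>R 2) powr (1 / q))"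
    by (simp only: powr_mult mult_ac)
  also have "2 powr (1 / p) * 2 powr (1 / q) = (2::real)"
    using qf by (simp flip: powr_add)
  finally have "cal_B p (\<zeta>0, \<eta>0, Z0, H0) + cal_B p (\<zeta>1, \<eta>1, Z1, H1) + ((y - k) \<bullet> \<eta>0 + (y + k) \<bullet> \<eta>1)
      \<le> 2 * (S powr (1 / p) * ((H0 + H1) /\<^sub>R 2) powr (1 / q))" .
  moreover have "(y - k) \<bullet> \<eta>0 + (y + k) \<bullet> \<eta>1 = 2 * (y \<bullet> \<eta>) + 2 * (norm h * norm e)"
    using k(2) by (simp add: pts inner_simps)
  ultimately have "(cal_B p (\<zeta>0, \<eta>0, Z0, H0) + cal_B p (\<zeta>1, \<eta>1, Z1, H1)) / 2 + norm h * norm e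
     \<le> S powr (1 / p) * ((H0 + H1) /\<^sub>R 2) powr (1 / q) - y \<bullet> \<eta>"
    by argo
  then show ?thesis unfolding h_def e_def S_def \<zeta>_def \<eta>_def q_def .
qed

text \<open>The first case of \<open>cal_B\<close> uses \<open>burk_phi\<close> with the best
  constant, the others \<open>burk_Psi\<close> with a fitted g. The margin \<epsilon> is spent at
  \<open>edge\<close>, where |y| is taken large, and at \<open>corner\<close>, where g is taken
  small.\<close>

lemma cal_B_attained:
  fixes \<zeta> \<eta> :: "'a::real_inner"
  assumes p: "1 < p" "p \<le> 2" and dom: "(\<zeta>, \<eta>, Z, H) \<in> bellman_dom p" and \<epsilon>: "0 < \<epsilon>"
  shows "\<exists>C (\<phi> :: 'a \<Rightarrow> 'a \<Rightarrow> real) y. bellman_majorant p C \<phi> \<and>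
    (C * Z + \<phi> \<zeta> y) powr (1 / p) * H powr (1 / conj_exponent p) - y \<bullet> \<eta> \<le> cal_B p (\<zeta>, \<eta>, Z, H) + \<epsilon>"
proof -
  define q where "q = conj_exponent p"
  note qf = conj_exponent_facts[OF p(1), folded q_def]
  note ZH = bellman_domD[OF dom, folded q_def]
  define K where "K = 1 / (p - 1)"
  have K: "0 < K" using p by (simp add: K_def)
  define r n where "r = norm \<zeta>" and "n = norm \<eta>"
  have rn: "0 \<le> r" "0 \<le> n" by (auto simp: r_def n_def)
  have ZH': "0 \<le> Z" "0 \<le> H" "r powr p \<le> Z" "n powr q \<le> H" using ZH by (auto simp: r_def n_def)
  have r_pos: "0 < r" if lt: "n powr q * Z < r powr p * H"
  proof -
    have "0 \<le> n powr q * Z" using ZH' by simp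
    then have "r powr p * H \<noteq> 0" using lt by linarith
    then show ?thesis using rn by (cases "r = 0") auto
  qed
  note phi = bellman_majorant_burk_phi[OF p, where 'a='a, folded K_def]
  consider (inner) "r powr p * H \<le> n powr q * Z" "n powr q < H"
    | (edge) "r powr p * H \<le> n powr q * Z" "n powr q = H"
    | (outer) "n powr q * Z < r powr p * H" "r powr p < Z"
    | (corner) "n powr q * Z < r powr p * H" "Z = r powr p"
    using ZH' by linarith
  then show ?thesis
  proof cases
    case inner
    \<comment> \<open>The length \<open>c\<close> of \<open>y\<close> is the equality case of Hoelder's inequality.\<close>
    define D where "D = H - n powr q"
    define A where "A = Z - r powr p"
    have D: "0 < D" and A: "0 \<le> A" using inner ZH' by (auto simp: D_def A_def)
    have H: "0 < H" using powr_ge_zero inner(2) by (rule le_less_trans)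
    have B: "cal_B p (\<zeta>, \<eta>, Z, H) = D powr (1 / q) * A powr (1 / p) * K"
      using inner by (simp add: cal_B_def Let_def q_def D_def A_def r_def n_def K_def)
    define c where "c = K * A powr (1 / p) * (n powr q / D) powr (1 / p)"
    have c0: "0 \<le> c" using K by (simp add: c_def)
    have "c = 0" if "\<eta> = 0" using that qf by (simp add: c_def n_def)
    then obtain y where ny: "norm y = c" "y \<bullet> \<eta> = c * n"
      using collinear_with_norm[OF c0] unfolding n_def by blast
    have cp: "c powr p = K powr p * A * (n powr q / D)"
      using p A D K by (simp add: c_def powr_mult powr_powr)
    \<comment> \<open>The case condition says exactly that y falls into the region where
      \<open>burk_phi\<close> is the obstacle.\<close>
    have "r powr p * D \<le> A * n powr q" using inner by (simp add: D_def A_def algebra_simps)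
    then have "r powr p \<le> A * (n powr q / D)" using D by (simp add: field_simps)
    then have "K powr p * r powr p \<le> c powr p" unfolding cp mult.assoc by (intro mult_left_mono) auto
    then have "(K * r) powr p \<le> c powr p" by (simp add: powr_mult)
    then have Kr: "K * r \<le> c"
      using powr_less_mono2[of p c "K * r"] p c0 by (meson less_le_not_le not_le_imp_less order_less_trans zero_less_one)
    have "K powr p * Z + burk_phi p \<zeta> y = K powr p * A + c powr p"
      using Kr by (simp add: burk_phi_def ny K_def[symmetric] A_def r_def algebra_simps) (simp add: K_def)
    also have "\<dots> = K powr p * A * (H / D)"
      using D by (simp add: cp D_def field_simps)
    finally have S: "K powr p * Z + burk_phi p \<zeta> y = K powr p * A * (H / D)" .
    have "(K powr p * A * (H / D)) powr (1 / p) * H powr (1 / q)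
       = K * A powr (1 / p) * (H powr (1 / p) * H powr (1 / q)) / D powr (1 / p)"
      using p K A D H by (simp add: powr_mult powr_divide powr_powr mult_ac)
    also have "H powr (1 / p) * H powr (1 / q) = H" using qf H by (simp flip: powr_add)
    finally have 1: "(K powr p * Z + burk_phi p \<zeta> y) powr (1 / p) * H powr (1 / q) = K * A powr (1 / p) * H / D powr (1 / p)"
      by (simp add: S)
    have "c * n = K * A powr (1 / p) * n powr q / D powr (1 / p)"
    proof -
      have "(n powr q) powr (1 / p) * n = n powr q"
      proof (cases "n = 0")
        case False
        have "q / p + 1 = q" using p by (simp add: q_def conj_exponent_def field_simps)
        then have "n powr (q / p) * n powr 1 = n powr q" using False by (simp only: powr_add[symmetric])
        then show ?thesis using False rn by (simp add: powr_powr)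
      qed simp
      then show ?thesis using D by (simp add: c_def powr_divide)
    qed
    with 1 have "(K powr p * Z + burk_phi p \<zeta> y) powr (1 / p) * H powr (1 / q) - y \<bullet> \<eta> = K * A powr (1 / p) * (D / D powr (1 / p))"
      by (simp add: ny D_def right_diff_distrib diff_divide_distrib)
    also have "D / D powr (1 / p) = D powr (1 / q)"
    proof -
      have "1 / q = 1 - 1 / p" using qf by simp
      then show ?thesis using D by (simp only: powr_diff) simp
    qed
    finally show ?thesis
      using phi \<epsilon> B unfolding q_def[symmetric] by (intro exI[of _ "K powr p"] exI[of _ "burk_phi p"] exI[of _ y]) simp
  next
    case edge
    have B: "cal_B p (\<zeta>, \<eta>, Z, H) = 0"
      using edge qf by (simp add: cal_B_def Let_def q_def r_def n_def)
    define A where "A = K powr p * (Z - r powr p)"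
    have A: "0 \<le> A" using ZH' by (simp add: A_def)
    \<comment> \<open>For |y| = c the competitor is at most \<open>A * c powr (1 - p) * n\<close>,
      which tends to 0 as c grows; \<open>K * r \<le> c\<close> keeps y in the obstacle
      region.\<close>
    have "((\<lambda>c. A * c powr (1 - p) * n) \<longlongrightarrow> A * 0 * n) at_top"
      using p by (intro tendsto_intros tendsto_neg_powr filterlim_ident) auto
    then have "\<forall>\<^sub>F c in at_top. A * c powr (1 - p) * n < \<epsilon>"
      using \<epsilon> by (intro order_tendstoD) auto
    moreover have "\<forall>\<^sub>F c in at_top. max 1 (K * r) \<le> c" by (rule eventually_ge_at_top)
    ultimately have "\<forall>\<^sub>F c in at_top. A * c powr (1 - p) * n < \<epsilon> \<and> max 1 (K * r) \<le> c"
      by eventually_elim simp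
    then have "\<exists>c. A * c powr (1 - p) * n < \<epsilon> \<and> max 1 (K * r) \<le> c"
      by (intro eventually_happens'[OF trivial_limit_at_top_linorder])
    then obtain c where c: "A * c powr (1 - p) * n < \<epsilon>" "1 \<le> c" "K * r \<le> c"
      by auto
    show ?thesis
    proof (cases "n = 0")
      case True
      then have "H = 0" using edge by simp
      then show ?thesis
        using phi \<epsilon> B True by (intro exI[of _ "K powr p"] exI[of _ "burk_phi p"] exI[of _ 0]) simp
    next
      case False
      obtain y where ny: "norm y = c" "y \<bullet> \<eta> = c * n"
        using collinear_with_norm[of c \<eta>] c False unfolding n_def by auto
      have S: "K powr p * Z + burk_phi p \<zeta> y = A + c powr p"
        using c by (simp add: burk_phi_def ny K_def[symmetric] A_def r_def algebra_simps) (simp add: K_def)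
      have "A + c powr p = c powr p * (1 + A / c powr p)" using c by (simp add: distrib_left)
      then have "(A + c powr p) powr (1 / p) = c * (1 + A / c powr p) powr (1 / p)"
        using c p by (simp add: powr_mult powr_powr)
      also have "\<dots> \<le> c * (1 + A / c powr p)"
        using powr_mono[of "1 / p" 1 "1 + A / c powr p"] A c p by (intro mult_left_mono) auto
      also have "\<dots> = c + A * c powr (1 - p)" using c by (simp add: powr_diff distrib_left)
      finally have "(A + c powr p) powr (1 / p) * n \<le> (c + A * c powr (1 - p)) * n"
        using rn(2) by (rule mult_right_mono)
      moreover have "H powr (1 / q) = n" using edge(2)[symmetric] rn qf by (simp add: powr_powr)
      ultimately have "(K powr p * Z + burk_phi p \<zeta> y) powr (1 / p) * H powr (1 / q) - y \<bullet> \<eta> \<le> \<epsilon>"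
        using c(1) by (simp add: S ny distrib_right)
      then show ?thesis
        using phi B unfolding q_def[symmetric] by (intro exI[of _ "K powr p"] exI[of _ "burk_phi p"] exI[of _ y]) simp
    qed
  next
    case outer
    define \<rho> where "\<rho> = Z / norm \<zeta> powr p"
    obtain g Y \<theta> where gY: "0 \<le> Y" "Y < g" "g < 1 / (p - 1)" "0 \<le> \<theta>" "\<theta> < 1"
      "burk_F p Y = \<rho> * burk_F p g" "burk_M p Y = \<theta> * burk_M p g"
      "\<theta> / \<rho> * (Z powr (1 / p) * H powr (1 / q)) = norm \<zeta> * norm \<eta>"
      "norm \<eta> = 0 \<Longrightarrow> \<theta> = 0"
      "cal_B p (\<zeta>, \<eta>, Z, H) = g * Z powr (1 / p) * H powr (1 / q) - norm \<zeta> * norm \<eta> * Y"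
      by (rule cal_B_system[OF p dom outer(1)[unfolded r_def n_def q_def] outer(2)[unfolded r_def],
            folded q_def \<rho>_def]) blast
    have r: "0 < r" using outer(1) by (rule r_pos)
    have Z: "0 < Z" using powr_ge_zero outer(2) by (rule le_less_trans)
    have g: "0 < g" using gY by simp
    \<comment> \<open>For \<eta> = 0 only y = 0 is parallel to \<eta>; here \<theta> = 0 forces Y =
      0, so the required length is 0.\<close>
    have "Y = 0" if "\<eta> = 0"
      using that gY burk_M_pos[of Y p] by (cases "Y = 0") auto
    then obtain y where ny: "norm y = r * Y" "y \<bullet> \<eta> = r * Y * n"
      using collinear_with_norm[of "r * Y" \<eta>] gY r unfolding n_def by auto
    \<comment> \<open>With |y| = r Y the first equation moves the argument from Y to g, where the
      majorization is an equality.\<close>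
    have "burk_W p (norm \<zeta>) (norm y) = Z * burk_F p g"
      using burk_W_eq_burk_F[of r "r * Y" p] r gY Z by (simp add: ny r_def[symmetric] \<rho>_def)
    moreover have "a * Z + - (b * (Z * f)) = Z * (a - b * f)" for a b f :: real
      by (simp add: algebra_simps)
    ultimately have "burk_C p g * Z + burk_Psi p g \<zeta> y = Z * (burk_C p g - burk_kappa p g / (p - 1) * burk_F p g)"
      unfolding burk_Psi_def by (simp only:)
    also have "\<dots> = Z * g powr p"
      using burk_majorization(2)[OF p g] by simp
    finally have "(burk_C p g * Z + burk_Psi p g \<zeta> y) powr (1 / p) = g * Z powr (1 / p)"
      using p g by (simp add: powr_mult powr_powr)
    then have "(burk_C p g * Z + burk_Psi p g \<zeta> y) powr (1 / p) * H powr (1 / q) - y \<bullet> \<eta> = cal_B p (\<zeta>, \<eta>, Z, H)"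
      using gY by (simp add: ny r_def n_def)
    then show ?thesis
      using bellman_majorant_burk_Psi[OF p g] \<epsilon> unfolding q_def[symmetric]
      by (intro exI[of _ "burk_C p g"] exI[of _ "burk_Psi p g"] exI[of _ y]) simp
  next
    case corner
    have B: "cal_B p (\<zeta>, \<eta>, Z, H) = 0"
      using corner by (simp add: cal_B_def Let_def q_def r_def n_def)
    have r: "0 < r" using corner(1) by (rule r_pos)
    \<comment> \<open>A vector y of length g r gives a competitor of at most g b, so g is chosen
      with g b <= \<epsilon>; the summand in b + 1 avoids division by 0.\<close>
    define b where "b = r * (H powr (1 / q) + n)"
    have b: "0 \<le> b" using r rn by (simp add: b_def)
    define g where "g = \<epsilon> / (b + 1)"
    have g: "0 < g" "g * b \<le> \<epsilon>" using b \<epsilon> by (auto simp: g_def field_simps)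
    define y where "y = g *\<^sub>R \<zeta>"
    have ny: "norm y = g * r" using g by (simp add: y_def r_def)
    have "burk_W p (norm \<zeta>) (norm y) = Z * burk_F p g"
      using burk_W_eq_burk_F[of r "g * r" p] r g corner by (simp add: ny r_def[symmetric])
    moreover have "a * Z + - (b * (Z * f)) = Z * (a - b * f)" for a b f :: real
      by (simp add: algebra_simps)
    ultimately have "burk_C p g * Z + burk_Psi p g \<zeta> y = Z * (burk_C p g - burk_kappa p g / (p - 1) * burk_F p g)"
      unfolding burk_Psi_def by (simp only:)
    also have "\<dots> = Z * g powr p"
      using burk_majorization(2)[OF p g(1)] by simp
    finally have S: "(burk_C p g * Z + burk_Psi p g \<zeta> y) powr (1 / p) = g * r"
      using p g r corner by (simp add: powr_mult powr_powr)
    have "- (y \<bullet> \<eta>) \<le> g * r * n"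
      using norm_cauchy_schwarz[of "- y" \<eta>] by (simp add: ny n_def)
    then have "(burk_C p g * Z + burk_Psi p g \<zeta> y) powr (1 / p) * H powr (1 / q) - y \<bullet> \<eta> \<le> g * b"
      unfolding S b_def by (simp add: algebra_simps)
    then show ?thesis
      using bellman_majorant_burk_Psi[OF p g(1)] g(2) B unfolding q_def[symmetric]
      by (intro exI[of _ "burk_C p g"] exI[of _ "burk_Psi p g"] exI[of _ y]) simp
  qed
qed

section \<open>The midpoint inequality and the bounds for p at most 2\<close>

lemma bellman_dom_midpoint:
  fixes \<zeta>0 \<zeta>1 \<eta>0 \<eta>1 :: "'a::real_inner"
  assumes p: "1 < p"
    and dom: "(\<zeta>0, \<eta>0, Z0, H0) \<in> bellman_dom p" "(\<zeta>1, \<eta>1, Z1, H1) \<in> bellman_dom p"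
  shows "((\<zeta>0 + \<zeta>1) /\<^sub>R 2, (\<eta>0 + \<eta>1) /\<^sub>R 2, (Z0 + Z1) /\<^sub>R 2, (H0 + H1) /\<^sub>R 2) \<in> bellman_dom p"
proof -
  have conv: "norm ((u + v) /\<^sub>R 2) powr s \<le> (a + b) / 2"
    if s: "1 < s" and ab: "norm u powr s \<le> a" "norm v powr s \<le> b" for u v :: 'a and a b s
  proof -
    note sf = conj_exponent_facts[OF s]
    \<comment> \<open>Midpoint convexity of the power is Hoelder's inequality against the pair (1,
      1).\<close>
    have "norm u + norm v = (norm u powr s) powr (1 / s) * 1 powr (1 / conj_exponent s)
        + (norm v powr s) powr (1 / s) * 1 powr (1 / conj_exponent s)"
      using s by (simp add: powr_powr)
    also have "\<dots> \<le> (norm u powr s + norm v powr s) powr (1 / s) * (1 + 1) powr (1 / conj_exponent s)"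
      by (rule Hoelder_two) (use s sf in auto)
    finally have "(norm u + norm v) powr s \<le> ((norm u powr s + norm v powr s) powr (1 / s) * 2 powr (1 / conj_exponent s)) powr s"
      using s by (intro powr_mono2) auto
    also have "\<dots> = (norm u powr s + norm v powr s) * 2 powr (s - 1)"
      using s sf by (simp add: powr_mult powr_powr)
    finally have *: "(norm u + norm v) powr s \<le> (norm u powr s + norm v powr s) * 2 powr (s - 1)" .
    have "norm ((u + v) /\<^sub>R 2) powr s \<le> ((norm u + norm v) / 2) powr s"
      using s norm_triangle_ineq[of u v] by (intro powr_mono2) auto
    also have "\<dots> = (norm u + norm v) powr s / 2 powr s" by (simp add: powr_divide)
    also have "\<dots> \<le> (norm u powr s + norm v powr s) * 2 powr (s - 1) / 2 powr s"
      using * by (rule divide_right_mono) simp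
    also have "\<dots> = (norm u powr s + norm v powr s) / 2" by (simp add: powr_diff)
    finally show ?thesis using ab by simp
  qed
  note d = bellman_domD[OF dom(1)] bellman_domD[OF dom(2)]
  show ?thesis
    using conv[OF p d(3,7)] conv[OF conj_exponent_facts(1)[OF p] d(4,8)] d
    by (simp add: bellman_dom_def)
qed

text \<open>A nearly optimal competitor at the midpoint also bounds the average over the endpoints,
  with the product of norms to spare; the error \<epsilon> is arbitrary.\<close>

lemma cal_B_midpoint:
  fixes \<zeta>0 \<zeta>1 \<eta>0 \<eta>1 :: "'a::real_inner"
  assumes p: "1 < p" "p \<le> 2"
    and dom: "(\<zeta>0, \<eta>0, Z0, H0) \<in> bellman_dom p" "(\<zeta>1, \<eta>1, Z1, H1) \<in> bellman_dom p"
  shows "norm ((\<zeta>1 - \<zeta>0) /\<^sub>R 2) * norm ((\<eta>1 - \<eta>0) /\<^sub>R 2)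
    \<le> cal_B p ((\<zeta>0 + \<zeta>1) /\<^sub>R 2, (\<eta>0 + \<eta>1) /\<^sub>R 2, (Z0 + Z1) /\<^sub>R 2, (H0 + H1) /\<^sub>R 2)
      - (cal_B p (\<zeta>0, \<eta>0, Z0, H0) + cal_B p (\<zeta>1, \<eta>1, Z1, H1)) / 2"
proof (rule field_le_epsilon)
  fix \<epsilon> :: real assume "0 < \<epsilon>"
  from cal_B_attained[OF p bellman_dom_midpoint[OF p(1) dom] this]
  obtain C y and \<phi> :: "'a \<Rightarrow> 'a \<Rightarrow> real" where "bellman_majorant p C \<phi>"
    and le: "(C * ((Z0 + Z1) /\<^sub>R 2) + \<phi> ((\<zeta>0 + \<zeta>1) /\<^sub>R 2) y) powr (1 / p)
        * ((H0 + H1) /\<^sub>R 2) powr (1 / conj_exponent p) - y \<bullet> ((\<eta>0 + \<eta>1) /\<^sub>R 2)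
      \<le> cal_B p ((\<zeta>0 + \<zeta>1) /\<^sub>R 2, (\<eta>0 + \<eta>1) /\<^sub>R 2, (Z0 + Z1) /\<^sub>R 2, (H0 + H1) /\<^sub>R 2) + \<epsilon>"
    by blast
  from order_trans[OF bellman_majorant_midpoint[OF p(1) this(1) dom] le]
  show "norm ((\<zeta>1 - \<zeta>0) /\<^sub>R 2) * norm ((\<eta>1 - \<eta>0) /\<^sub>R 2)
    \<le> cal_B p ((\<zeta>0 + \<zeta>1) /\<^sub>R 2, (\<eta>0 + \<eta>1) /\<^sub>R 2, (Z0 + Z1) /\<^sub>R 2, (H0 + H1) /\<^sub>R 2)
      - (cal_B p (\<zeta>0, \<eta>0, Z0, H0) + cal_B p (\<zeta>1, \<eta>1, Z1, H1)) / 2 + \<epsilon>"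
    by argo
qed

text \<open>In the system case nonnegativity follows from Y < \<gamma> and |\<zeta>||\<eta>| <=
  \<open>Z powr (1 / p) * H powr (1 / q)\<close>, and the upper bound from \<gamma> < 1 / (p - 1).
  The other cases are read off the formulas.\<close>

lemma cal_B_bounds:
  fixes \<zeta> \<eta> :: "'a::real_inner"
  assumes p: "1 < p" "p \<le> 2" and dom: "(\<zeta>, \<eta>, Z, H) \<in> bellman_dom p"
  shows "0 \<le> cal_B p (\<zeta>, \<eta>, Z, H)"
    and "cal_B p (\<zeta>, \<eta>, Z, H) \<le> 1 / (p - 1) * Z powr (1 / p) * H powr (1 / conj_exponent p)"
proof -
  define q where "q = conj_exponent p"
  note qf = conj_exponent_facts[OF p(1), folded q_def]
  note ZH = bellman_domD[OF dom, folded q_def]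
  have "0 \<le> cal_B p (\<zeta>, \<eta>, Z, H) \<and> cal_B p (\<zeta>, \<eta>, Z, H) \<le> 1 / (p - 1) * Z powr (1 / p) * H powr (1 / q)"
  proof (cases "norm \<zeta> powr p * H \<le> norm \<eta> powr q * Z \<or> \<not> norm \<zeta> powr p < Z")
    case True
    have "0 \<le> cal_B p (\<zeta>, \<eta>, Z, H)" using True p ZH by (auto simp: cal_B_def Let_def q_def)
    moreover have "(H - norm \<eta> powr q) powr (1 / q) * (Z - norm \<zeta> powr p) powr (1 / p) / (p - 1)
        \<le> H powr (1 / q) * Z powr (1 / p) / (p - 1)"
      using p qf ZH by (intro divide_right_mono mult_mono powr_mono2) auto
    ultimately show ?thesis
      using cal_B_boundary_le[OF p dom, folded q_def, OF True] by (simp add: mult_ac)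
  next
    case False
    obtain g Y where gY: "0 \<le> Y" "Y < g" "g < 1 / (p - 1)"
      "cal_B p (\<zeta>, \<eta>, Z, H) = g * Z powr (1 / p) * H powr (1 / q) - norm \<zeta> * norm \<eta> * Y"
      using cal_B_system[OF p dom] False unfolding q_def[symmetric] by (metis not_le)
    have "norm \<zeta> \<le> Z powr (1 / p)"
      using powr_mono2[OF _ _ ZH(3), of "1 / p"] p by (simp add: powr_powr)
    moreover have "norm \<eta> \<le> H powr (1 / q)"
      using powr_mono2[OF _ _ ZH(4), of "1 / q"] qf by (simp add: powr_powr)
    ultimately have "norm \<zeta> * norm \<eta> * Y \<le> Z powr (1 / p) * H powr (1 / q) * g"
      using gY by (intro mult_mono) auto
    moreover have "g * (Z powr (1 / p) * H powr (1 / q)) \<le> 1 / (p - 1) * (Z powr (1 / p) * H powr (1 / q))"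
      using gY by (intro mult_right_mono) auto
    moreover have "0 \<le> norm \<zeta> * norm \<eta> * Y" using gY by simp
    ultimately show ?thesis by (simp add: gY(4) mult_ac)
  qed
  then show "0 \<le> cal_B p (\<zeta>, \<eta>, Z, H)"
    and "cal_B p (\<zeta>, \<eta>, Z, H) \<le> 1 / (p - 1) * Z powr (1 / p) * H powr (1 / conj_exponent p)"
    by (auto simp: q_def)
qed

section \<open>Both ranges of the exponent\<close>

theorem theorem1p1:
  fixes p q pstar :: real
  assumes "1 < p"
    and "q = p / (p - 1)"
    and "pstar = max p (p / (p - 1))"
  shows "(\<forall>(\<zeta> :: 'a::{real_inner, complete_space}) \<eta> Z H.
            (\<zeta>, \<eta>, Z, H) \<in> bellman_dom p \<longrightarrow>
              0 \<le> bellman_B p (\<zeta>, \<eta>, Z, H) \<and>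
              bellman_B p (\<zeta>, \<eta>, Z, H) \<le> (pstar - 1) * Z powr (1 / p) * H powr (1 / q))
       \<and> (\<forall>(\<zeta>\<^sub>0 :: 'a) \<eta>\<^sub>0 Z\<^sub>0 H\<^sub>0 \<zeta>\<^sub>1 \<eta>\<^sub>1 Z\<^sub>1 H\<^sub>1.
            (\<zeta>\<^sub>0, \<eta>\<^sub>0, Z\<^sub>0, H\<^sub>0) \<in> bellman_dom p \<longrightarrow>
            (\<zeta>\<^sub>1, \<eta>\<^sub>1, Z\<^sub>1, H\<^sub>1) \<in> bellman_dom p \<longrightarrow>
              bellman_B p (((\<zeta>\<^sub>0, \<eta>\<^sub>0, Z\<^sub>0, H\<^sub>0) + (\<zeta>\<^sub>1, \<eta>\<^sub>1, Z\<^sub>1, H\<^sub>1)) /\<^sub>R 2)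
                - (bellman_B p (\<zeta>\<^sub>0, \<eta>\<^sub>0, Z\<^sub>0, H\<^sub>0) + bellman_B p (\<zeta>\<^sub>1, \<eta>\<^sub>1, Z\<^sub>1, H\<^sub>1)) / 2
              \<ge> norm ((\<zeta>\<^sub>1 - \<zeta>\<^sub>0) /\<^sub>R 2) * norm ((\<eta>\<^sub>1 - \<eta>\<^sub>0) /\<^sub>R 2))"
proof (cases "p \<le> 2")
  case True
  have q: "q = conj_exponent p" using assms by (simp add: conj_exponent_def)
  have "p \<le> p / (p - 1)"
  proof -
    have "p * (p - 1) \<le> p * 1" using True assms by (intro mult_left_mono) auto
    then show ?thesis using assms by (simp add: field_simps)
  qed
  then have pstar: "pstar - 1 = 1 / (p - 1)" using assms by (simp add: field_simps)
  have B: "bellman_B p = (cal_B p :: 'a \<times> 'a \<times> real \<times> real \<Rightarrow> real)"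
    using True by (auto simp: bellman_B_def)
  show ?thesis
    unfolding B q pstar add_Pair scaleR_Pair
    using cal_B_bounds[OF assms(1) True, where 'a='a] cal_B_midpoint[OF assms(1) True, where 'a='a]
    by blast
next
  case False
  \<comment> \<open>For p > 2 the conjugate exponent lies in (1, 2), and conjugation is an
    involution, so interchanging (\<zeta>, Z) with (\<eta>, H) reduces everything to the case
    treated before.\<close>
  define s where "s = conj_exponent p"
  note sf = conj_exponent_facts[OF assms(1), folded s_def]
  have q: "q = s" using assms by (simp add: s_def conj_exponent_def)
  have s: "1 < s" "s \<le> 2" using sf False by (auto simp: s_def conj_exponent_def field_simps)
  have "p / (p - 1) \<le> p"
  proof -
    have "p * 1 \<le> p * (p - 1)" using False by (intro mult_left_mono) auto
    then show ?thesis using False by (simp add: field_simps)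
  qed
  then have "pstar = p" using assms by simp
  moreover have "p - 1 = 1 / (s - 1)" using assms by (simp add: s_def conj_exponent_def field_simps)
  ultimately have pstar: "pstar - 1 = 1 / (s - 1)" by simp
  have B: "bellman_B p (\<zeta>, \<eta>, Z, H) = cal_B s (\<eta>, \<zeta>, H, Z)" for \<zeta> \<eta> :: 'a and Z H
    using False by (simp add: bellman_B_def s_def)
  have dom: "(\<zeta>, \<eta>, Z, H) \<in> bellman_dom p \<longleftrightarrow> (\<eta>, \<zeta>, H, Z) \<in> bellman_dom s" for \<zeta> \<eta> :: 'a and Z H
    using sf by (auto simp: bellman_dom_def s_def)
  have bounds: "0 \<le> cal_B s (\<eta>, \<zeta>, H, Z) \<and> cal_B s (\<eta>, \<zeta>, H, Z) \<le> (pstar - 1) * Z powr (1 / p) * H powr (1 / s)"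
    if "(\<eta>, \<zeta>, H, Z) \<in> bellman_dom s" for \<zeta> \<eta> :: 'a and Z H
    using cal_B_bounds[OF s that] by (simp add: sf pstar mult_ac)
  have mid: "norm ((\<zeta>1 - \<zeta>0) /\<^sub>R 2) * norm ((\<eta>1 - \<eta>0) /\<^sub>R 2)
    \<le> cal_B s ((\<eta>0 + \<eta>1) /\<^sub>R 2, (\<zeta>0 + \<zeta>1) /\<^sub>R 2, (H0 + H1) /\<^sub>R 2, (Z0 + Z1) /\<^sub>R 2)
      - (cal_B s (\<eta>0, \<zeta>0, H0, Z0) + cal_B s (\<eta>1, \<zeta>1, H1, Z1)) / 2"
    if "(\<eta>0, \<zeta>0, H0, Z0) \<in> bellman_dom s" "(\<eta>1, \<zeta>1, H1, Z1) \<in> bellman_dom s"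
    for \<zeta>0 \<eta>0 \<zeta>1 \<eta>1 :: 'a and Z0 H0 Z1 H1
    by (subst mult.commute) (rule cal_B_midpoint[OF s that])
  show ?thesis
    unfolding add_Pair scaleR_Pair B dom q using bounds mid by blast
qed

end
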